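(* Let $G$ be a free semigroup acting on a compact metric space $(X,d)$ with a finite generator set $\mathcal{G}=\{f_1,\dots,f_k\}$ of continuous self-maps of $X$. Let $f\in C(X,\mathbb{R})$, let $Z\subset X$ be a nonempty compact set, and suppose that $P^{P}_{\mathcal{G}}(Z,f)>\|f\|$, where $\|f\|:=\sup_{x\in X}|f(x)|$. Then $$P^{P}_{\mathcal{G}}(Z,f)=\lim_{\varepsilon\to 0}\sup\{\overline{P}_{\mu,\mathcal{G}}(Z,f,\varepsilon):\mu\in M(X),\ \mu(Z)=1\}.$$
   Context: Setting. $(X,d)$ is a compact metric space, $\mathcal{G}=\{f_1,\dots,f_k\}$ is a finite family of continuous self-maps of $X$, and $G=\bigcup_{n\in\mathbb{N}}G_n$ is the free semigroup generated by $\mathcal{G}$, where $G_n=\{g_1\circ\cdots\circ g_m: 1\le m<n,\ g_1,\dots,g_m\in\mathcal{G}\}\cup\{\mathrm{id}_X\}$ for $n\ge 1$. Since the semigroup is free, distinct words in the generators count as distinct elements, so that $|G_n|=\sum_{i=0}^{n-1}k^i$. $C(X,\mathbb{R})$ is the set of continuous real functions on $X$ and $M(X)$ is the set of Borel probability measures on $X$. Bowen balls. $d_n(x,y)=\max_{g\in G_n}d(gx,gy)$; for $\varepsilon>0$, $B_n(x,e^{-n\varepsilon})=\{y\in X:d_n(x,y)<e^{-n\varepsilon}\}$ and $\overline{B}_n(x,e^{-n\varepsilon})=\{y\in X:d_n(x,y)\le e^{-n\varepsilon}\}$. For $f\in C(X,\mathbb{R})$, $f_n(x)=\sum_{g\in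 G_n}f(g(x))$. Neutralized packing pressure. For $Z\subset X$, $n\in\mathbb{N}$, $\alpha\in\mathbb{R}$, $\varepsilon>0$, let $$M^{P}_{\mathcal{G}}(n,\alpha,\varepsilon,Z,f)=\sup\Big\{\sum_i e^{-\alpha|G_{n_i}|+f_{n_i}(x_i)}\Big\},$$ the supremum being over all finite or countable pairwise disjoint collections $\{\overline{B}_{n_i}(x_i,e^{-n_i\varepsilon})\}_i$ with $x_i\in Z$ and $n_i\ge n$ for all $i$. This is nonincreasing in $n$; let $M^{P}_{\mathcal{G}}(\alpha,\varepsilon,Z,f)=\lim_{n\to\infty}M^{P}_{\mathcal{G}}(n,\alpha,\varepsilon,Z,f)$ and $$M^{\mathcal{P}}_{\mathcal{G}}(\alpha,\varepsilon,Z,f)=\inf\Big\{\sum_{i=1}^{\infty}M^{P}_{\mathcal{G}}(\alpha,\varepsilon,Z_i,f):Z\subseteq\bigcup_{i=1}^\infty Z_i\Big\}.$$ As $\alpha$ goes from $-\infty$ to $+\infty$, this quantity jumps from $+\infty$ to $0$ at a critical value, denoted $$P^{P}_{\mathcal{G}}(\varepsilon,Z,f)=\sup\{\alpha:M^{\mathcal{P}}_{\mathcal{G}}(\alpha,\varepsilon,Z,f)=+\infty\}=\inf\{\alpha:M^{\mathcal{P}}_{\mathcal{G}}(\alpha,\varepsilon,Z,f)=0\}.$$ It does not increase as $\varepsilon$ decreases, and the neutralized packing topological pressure is $P^{P}_{\mathcal{G}}(Z,f)=\lim_{\varepsilon\to0}P^{P}_{\mathcal{G}}(\varepsilon,Z,f)$.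 Measure-theoretic quantities. For $\mu\in M(X)$, $\varepsilon>0$, $x\in X$, $$\overline{P}_{\mu,\mathcal{G}}(x,f,\varepsilon)=\limsup_{n\to\infty}\frac{-\log\mu(B_n(x,e^{-n\varepsilon}))+f_n(x)}{|G_n|},\qquad \overline{P}_{\mu,\mathcal{G}}(Z,f,\varepsilon)=\int_Z\overline{P}_{\mu,\mathcal{G}}(x,f,\varepsilon)\,d\mu(x).$$ *)

theory Defs
  imports "HOL-Probability.Probability_Measure"
begin

text \<open>
  The phase space is a type of class \<open>metric_space\<close>, assumed compact in the theorem.
  The generators are a family \<open>F 1, \<dots>, F k\<close>; since the semigroup is free, its elements are
  represented by words over \<open>{1..k}\<close>, so that distinct words count as distinct
  elements even if they induce the same map.
\<close>

definition word_map :: "(nat \<Rightarrow> 'a \<Rightarrow> 'a) \<Rightarrow> nat list \<Rightarrow> 'a \<Rightarrow> 'a" where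
  "word_map F w = foldr (\<lambda>i h. F i \<circ> h) w id"

text \<open>\<open>words k n\<close> is \<open>G\<^sub>n\<close>; the empty word is the identity.\<close>

definition words :: "nat \<Rightarrow> nat \<Rightarrow> nat list set" where
  "words k n = {w \<in> lists {1..k}. 1 \<le> length w \<and> length w < n} \<union> {[]}"

lemma words_eq:
  assumes "1 \<le> n"
  shows "words k n = (\<Union>i<n. {w. set w \<subseteq> {1..k} \<and> length w = i})"
  using assms by (auto simp: words_def Suc_le_eq)

lemma finite_words: "finite (words k n)"
proof -
  have "words k n \<subseteq> {w. set w \<subseteq> {1..k} \<and> length w \<le> n}"
    by (auto simp: words_def)
  then show ?thesis
    using finite_lists_length_le[of "{1..k}" n] finite_subset by blast
qed

lemma card_words:
  assumes "1 \<le> n"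
  shows "card (words k n) = (\<Sum>i<n. k ^ i)"
proof -
  have "card (\<Union>i<n. {w. set w \<subseteq> {1..k} \<and> length w = i})
      = (\<Sum>i<n. card {w. set w \<subseteq> {1..k} \<and> length w = i})"
    by (rule card_UN_disjoint) (auto simp: finite_lists_length_eq)
  then show ?thesis
    using assms by (simp add: words_eq card_lists_length_eq)
qed

definition bowen_dist ::
  "nat \<Rightarrow> (nat \<Rightarrow> 'a \<Rightarrow> 'a) \<Rightarrow> nat \<Rightarrow> 'a::metric_space \<Rightarrow> 'a \<Rightarrow> real" where
  "bowen_dist k F n x y = (MAX w\<in>words k n. dist (word_map F w x) (word_map F w y))"

definition bowen_ball ::
  "nat \<Rightarrow> (nat \<Rightarrow> 'a \<Rightarrow> 'a) \<Rightarrow> nat \<Rightarrow> real \<Rightarrow> 'a::metric_space \<Rightarrow> 'a set" where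
  "bowen_ball k F n \<epsilon> x = {y. bowen_dist k F n x y < exp (- real n * \<epsilon>)}"

definition bowen_cball ::
  "nat \<Rightarrow> (nat \<Rightarrow> 'a \<Rightarrow> 'a) \<Rightarrow> nat \<Rightarrow> real \<Rightarrow> 'a::metric_space \<Rightarrow> 'a set" where
  "bowen_cball k F n \<epsilon> x = {y. bowen_dist k F n x y \<le> exp (- real n * \<epsilon>)}"

definition orbit_sum ::
  "nat \<Rightarrow> (nat \<Rightarrow> 'a \<Rightarrow> 'a) \<Rightarrow> ('a \<Rightarrow> real) \<Rightarrow> nat \<Rightarrow> 'a \<Rightarrow> real" where
  "orbit_sum k F f n x = (\<Sum>w\<in>words k n. f (word_map F w x))"

text \<open>
  A collection of Bowen balls is given by the countable set of its pairs (centre, order).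
  Nothing is lost against indexed families, because a pair cannot occur twice in a
  pairwise disjoint family of nonempty balls.
\<close>

definition packings ::
  "nat \<Rightarrow> (nat \<Rightarrow> 'a \<Rightarrow> 'a) \<Rightarrow> nat \<Rightarrow> real \<Rightarrow> 'a::metric_space set \<Rightarrow> ('a \<times> nat) set set" where
  "packings k F n \<epsilon> Z =
     {C. countable C \<and> (\<forall>(x, m)\<in>C. x \<in> Z \<and> n \<le> m) \<and>
         disjoint_family_on (\<lambda>(x, m). bowen_cball k F m \<epsilon> x) C}"

definition packing_sum ::
  "nat \<Rightarrow> (nat \<Rightarrow> 'a \<Rightarrow> 'a) \<Rightarrow> ('a \<Rightarrow> real) \<Rightarrow> nat \<Rightarrow> real \<Rightarrow> real \<Rightarrow> 'a::metric_space set \<Rightarrow> ennreal"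
  where
  "packing_sum k F f n \<alpha> \<epsilon> Z =
     (SUP C\<in>packings k F n \<epsilon> Z.
        infsum (\<lambda>(x, m). ennreal (exp (- \<alpha> * real (card (words k m)) + orbit_sum k F f m x))) C)"

definition packing_premeasure ::
  "nat \<Rightarrow> (nat \<Rightarrow> 'a \<Rightarrow> 'a) \<Rightarrow> ('a \<Rightarrow> real) \<Rightarrow> real \<Rightarrow> real \<Rightarrow> 'a::metric_space set \<Rightarrow> ennreal"
  where
  "packing_premeasure k F f \<alpha> \<epsilon> Z = lim (\<lambda>n. packing_sum k F f n \<alpha> \<epsilon> Z)"

definition packing_measure ::
  "nat \<Rightarrow> (nat \<Rightarrow> 'a \<Rightarrow> 'a) \<Rightarrow> ('a \<Rightarrow> real) \<Rightarrow> real \<Rightarrow> real \<Rightarrow> 'a::metric_space set \<Rightarrow> ennreal"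
  where
  "packing_measure k F f \<alpha> \<epsilon> Z =
     (INF A\<in>{A :: nat \<Rightarrow> 'a set. Z \<subseteq> (\<Union>i. A i)}. \<Sum>i. packing_premeasure k F f \<alpha> \<epsilon> (A i))"

text \<open>
  The critical value; it takes values in the extended reals, as the pressure may be infinite.
\<close>

definition packing_pressure_at ::
  "nat \<Rightarrow> (nat \<Rightarrow> 'a \<Rightarrow> 'a) \<Rightarrow> ('a \<Rightarrow> real) \<Rightarrow> real \<Rightarrow> 'a::metric_space set \<Rightarrow> ereal" where
  "packing_pressure_at k F f \<epsilon> Z =
     (SUP \<alpha>\<in>{\<alpha> :: real. packing_measure k F f \<alpha> \<epsilon> Z = \<infinity>}. ereal \<alpha>)"

definition packing_pressure ::
  "nat \<Rightarrow> (nat \<Rightarrow> 'a \<Rightarrow> 'a) \<Rightarrow> ('a \<Rightarrow> real) \<Rightarrow> 'a::metric_space set \<Rightarrow> ereal" where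
  "packing_pressure k F f Z = Lim (at_right 0) (\<lambda>\<epsilon>. packing_pressure_at k F f \<epsilon> Z)"

text \<open>\<open>- log t\<close> for \<open>t \<ge> 0\<close> with \<open>- log 0 = \<infinity>\<close> (the library has \<open>ln 0 = 0\<close>).\<close>

definition neg_log :: "real \<Rightarrow> ereal" where
  "neg_log t = (if t = 0 then \<infinity> else ereal (- ln t))"

definition local_pressure ::
  "nat \<Rightarrow> (nat \<Rightarrow> 'a \<Rightarrow> 'a) \<Rightarrow> ('a \<Rightarrow> real) \<Rightarrow> 'a measure \<Rightarrow> real \<Rightarrow> 'a::metric_space \<Rightarrow> ereal" where
  "local_pressure k F f \<mu> \<epsilon> x =
     limsup (\<lambda>n. (neg_log (measure \<mu> (bowen_ball k F n \<epsilon> x)) + ereal (orbit_sum k F f n x))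
                 / ereal (real (card (words k n))))"

text \<open>
  The integral of an extended-real function over a set, as the integral of the positive part
  minus that of the negative part (\<open>e2ennreal\<close> sends negative values to \<open>0\<close>). The local pressure
  of a continuous \<open>f\<close> on a compact space is bounded below by \<open>- \<parallel>f\<parallel>\<close>, so for a
  probability measure the subtraction is never \<open>\<infinity> - \<infinity>\<close>.
\<close>

definition ereal_set_integral :: "'a measure \<Rightarrow> 'a set \<Rightarrow> ('a \<Rightarrow> ereal) \<Rightarrow> ereal" where
  "ereal_set_integral M A \<phi> =
     enn2ereal (\<integral>\<^sup>+x\<in>A. e2ennreal (\<phi> x) \<partial>M) - enn2ereal (\<integral>\<^sup>+x\<in>A. e2ennreal (- \<phi> x) \<partial>M)"

definition measure_pressure ::
  "nat \<Rightarrow> (nat \<Rightarrow> 'a \<Rightarrow> 'a) \<Rightarrow> ('a \<Rightarrow> real) \<Rightarrow> 'a measure \<Rightarrow> 'a::metric_space set \<Rightarrow> real \<Rightarrow> ereal" where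
  "measure_pressure k F f \<mu> Z \<epsilon> = ereal_set_integral \<mu> Z (local_pressure k F f \<mu> \<epsilon>)"

definition borel_probs :: "'a::topological_space measure set" where
  "borel_probs = {\<mu>. prob_space \<mu> \<and> sets \<mu> = sets borel}"

end

theory Submission
  imports Defs
begin

text \<open>
  Write \<open>P(\<epsilon>)\<close> for the packing pressure at scale \<open>\<epsilon>\<close> and \<open>S(\<epsilon>)\<close> for the supremum of the measure pressures
  over the probability measures carried by \<open>Z\<close>. Larger \<open>\<epsilon>\<close> means smaller balls and more packings, so
  \<open>P\<close> is nondecreasing and the packing pressure \<open>P(0+)\<close> is its infimum. The theorem follows by squeezing
  \<open>P(0+) \<le> S(\<epsilon>) \<le> P(2\<epsilon>)\<close> for every \<open>\<epsilon> > 0\<close>. Passing between two different scales is what makes the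
  covering and perturbation arguments work: for \<open>\<epsilon> < \<epsilon>'\<close>, balls of order \<open>n\<close> at the finer scale \<open>\<epsilon>'\<close> have
  a radius smaller by the factor \<open>exp (- n (\<epsilon>' - \<epsilon>))\<close>.

  Upper bound (\<open>measure_pressure_le\<close>). Let the local pressure of \<open>\<mu>\<close> exceed \<open>s\<close> on a set \<open>A\<close> whose packing
  premeasure of exponent \<open>\<alpha> < s\<close> at a finer scale is finite. For each \<open>n\<close>, the points of \<open>A\<close> with a light
  Bowen ball of order \<open>n\<close> are covered by light balls around separated centres; these centres form a
  packing at the finer scale, so the cover has measure \<open>O(exp (- (s - \<alpha>) n))\<close>. By Borel--Cantelli
  \<open>A\<close> lies in a null set. If \<open>P(\<epsilon>') < s\<close>, countably many such sets exhaust the part of \<open>Z\<close> with local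
  pressure above \<open>s\<close>.

  Lower bound (\<open>exists_measure_pressure_ge\<close>). For \<open>s < P(\<epsilon>)\<close> one passes to a subset of \<open>Z\<close> whose packing
  premeasure of exponent \<open>s\<close> is infinite near each of its points. There, inside small neighbourhoods
  of the finitely many centres of one packing, one finds finite packings of total weight at least
  one, and so on; the result is a tree of packings. In parallel the unit interval with Lebesgue
  measure is subdivided so that each ball receives a set of parameters of measure at most its weight.
  A parameter follows a branch of the tree and thereby determines a point of \<open>Z\<close>; the law of this
  point gives each Bowen ball in the tree, even after recentring, at most its weight, up to a factor
  \<open>exp 1\<close>. Hence its local pressure is at least \<open>s\<close> on a closed set of full measure. Building the measure
  as the image of Lebesgue measure replaces the usual weak limit of discrete measures.

  The hypothesis that the pressure exceeds the norm of \<open>f\<close> makes it positive, so that only levels \<open>s \<ge> 0\<close>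
  occur and the integral of the local pressure is governed by its positive part.
\<close>


section \<open>Bowen balls of a free semigroup action\<close>

lemma Nil_in_words: "[] \<in> words k n"
  by (simp add: words_def)

lemma card_words_pos: "0 < card (words k n)"
  using Nil_in_words finite_words card_gt_0_iff by blast

lemma card_words_ge:
  assumes "1 \<le> k"
  shows "n \<le> card (words k n)"
proof (cases "n = 0")
  case False
  have "(\<Sum>i<n. 1) \<le> (\<Sum>i<n. k ^ i)"
    by (rule sum_mono) (use assms in simp)
  then show ?thesis
    using False by (simp add: card_words)
qed simp

lemma bowen_dist_le_iff:
  "bowen_dist k F n x y \<le> r \<longleftrightarrow>
    (\<forall>w\<in>words k n. dist (word_map F w x) (word_map F w y) \<le> r)"
  unfolding bowen_dist_def using finite_words[of k n] Nil_in_words[of k n]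
  by (subst Max_le_iff) auto

lemma bowen_dist_less_iff:
  "bowen_dist k F n x y < r \<longleftrightarrow>
    (\<forall>w\<in>words k n. dist (word_map F w x) (word_map F w y) < r)"
  unfolding bowen_dist_def using finite_words[of k n] Nil_in_words[of k n]
  by (subst Max_less_iff) auto

lemma dist_word_map_le_bowen_dist:
  "w \<in> words k n \<Longrightarrow> dist (word_map F w x) (word_map F w y) \<le> bowen_dist k F n x y"
  using bowen_dist_le_iff by blast

lemma dist_le_bowen_dist: "dist x y \<le> bowen_dist k F n x y"
  using dist_word_map_le_bowen_dist[OF Nil_in_words, of F x y k n] by (simp add: word_map_def)

lemma bowen_dist_refl [simp]: "bowen_dist k F n x x = 0"
proof (rule antisym)
  show "bowen_dist k F n x x \<le> 0" by (simp add: bowen_dist_le_iff)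
  show "0 \<le> bowen_dist k F n x x" using dist_le_bowen_dist[of x x k F n] by simp
qed

lemma bowen_dist_commute: "bowen_dist k F n x y = bowen_dist k F n y x"
  by (simp add: bowen_dist_def dist_commute)

lemma bowen_dist_triangle:
  "bowen_dist k F n x z \<le> bowen_dist k F n x y + bowen_dist k F n y z"
  unfolding bowen_dist_le_iff
proof
  fix w assume "w \<in> words k n"
  then show "dist (word_map F w x) (word_map F w z) \<le> bowen_dist k F n x y + bowen_dist k F n y z"
    using dist_word_map_le_bowen_dist[of w k n F x y] dist_word_map_le_bowen_dist[of w k n F y z]
      dist_triangle[of "word_map F w x" "word_map F w z" "word_map F w y"] by linarith
qed

locale free_semigroup_action =
  fixes k :: nat and F :: "nat \<Rightarrow> 'a::metric_space \<Rightarrow> 'a" and f :: "'a \<Rightarrow> real"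
  assumes compact_space: "compact (UNIV :: 'a set)"
    and generators_nonempty: "1 \<le> k"
    and continuous_generator: "\<And>i. i \<in> {1..k} \<Longrightarrow> continuous_on UNIV (F i)"
    and continuous_potential: "continuous_on UNIV f"
begin

abbreviation word_count :: "nat \<Rightarrow> real" where
  "word_count n \<equiv> real (card (words k n))"

abbreviation weight :: "real \<Rightarrow> 'a \<times> nat \<Rightarrow> real" where
  "weight \<alpha> \<equiv> (\<lambda>(x, m). exp (- \<alpha> * word_count m + orbit_sum k F f m x))"

lemma word_count_ge: "real n \<le> word_count n"
  using card_words_ge[OF generators_nonempty] by simp

lemma continuous_word_map:
  assumes "w \<in> words k n"
  shows "continuous_on UNIV (word_map F w)"
proof -
  have "set w \<subseteq> {1..k}" using assms by (auto simp: words_def)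
  then show ?thesis
  proof (induction w)
    case Nil
    then show ?case by (simp add: word_map_def id_def)
  next
    case (Cons i w)
    have "continuous_on UNIV (F i)" "continuous_on UNIV (word_map F w)"
      using Cons continuous_generator by auto
    then have "continuous_on UNIV (F i \<circ> word_map F w)"
      using continuous_on_compose continuous_on_subset by blast
    then show ?case by (simp add: word_map_def)
  qed
qed

lemma open_bowen_dist_less: "open {y. bowen_dist k F n x y < r}"
proof -
  have "{y. bowen_dist k F n x y < r} =
      (\<Inter>w\<in>words k n. {y. dist (word_map F w x) (word_map F w y) < r})"
    by (auto simp: bowen_dist_less_iff)
  also have "open \<dots>"
    using finite_words
    by (intro open_INT ballI open_Collect_less continuous_intros continuous_word_map) auto
  finally show ?thesis .
qed

lemma continuous_orbit_sum: "continuous_on UNIV (orbit_sum k F f n)"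
  unfolding orbit_sum_def
  by (intro continuous_intros continuous_on_compose2[OF continuous_potential] continuous_word_map) auto

text \<open>
  By compactness finitely many balls of half the radius cover the space, and each contains at most
  one point of a separated set. Choosing greedily from these balls gives a maximal separated set.
\<close>

lemma finite_separated_cover:
  assumes "0 < r"
  shows "\<exists>D. finite D \<and> D \<subseteq> A \<and> (\<forall>x\<in>D. \<forall>y\<in>D. x \<noteq> y \<longrightarrow> r \<le> bowen_dist k F n x y) \<and>
      (\<forall>a\<in>A. \<exists>x\<in>D. bowen_dist k F n x a < r)"
proof -
  let ?B = "\<lambda>x. {y. bowen_dist k F n x y < r / 2}"
  have "x \<in> ?B x" for x using assms by simp
  then have cover: "UNIV \<subseteq> (\<Union>x\<in>UNIV. ?B x)" by blast
  obtain T where T: "finite T" "UNIV \<subseteq> (\<Union>x\<in>T. ?B x)"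
    by (rule compactE_image[OF compact_space _ cover, where thesis = thesis])
      (rule open_bowen_dist_less)
  \<comment> \<open>Induction over the half-balls: a point taken from one of them accounts for all points in it.\<close>
  have "\<exists>D. finite D \<and> D \<subseteq> A' \<and> (\<forall>x\<in>D. \<forall>y\<in>D. x \<noteq> y \<longrightarrow> r \<le> bowen_dist k F n x y) \<and>
      (\<forall>a\<in>A'. \<exists>x\<in>D. bowen_dist k F n x a < r)" if "A' \<subseteq> (\<Union>x\<in>T. ?B x)" for A'
    using T(1) that
  proof (induction T arbitrary: A')
    case empty
    then show ?case by (intro exI[of _ "{}"]) auto
  next
    case (insert u T)
    show ?case
    proof (cases "A' \<inter> ?B u = {}")
      case True
      then have "A' \<subseteq> (\<Union>x\<in>T. ?B x)" using insert.prems by auto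
      then show ?thesis by (rule insert.IH)
    next
      case False
      then obtain a where a: "a \<in> A'" "bowen_dist k F n u a < r / 2" by auto
      let ?A = "{x \<in> A'. r \<le> bowen_dist k F n a x}"
      have "?A \<subseteq> (\<Union>x\<in>T. ?B x)"
      proof
        fix x assume x: "x \<in> ?A"
        have "r / 2 \<le> bowen_dist k F n u x"
          using x a bowen_dist_triangle[of k F n a x u] by (simp add: bowen_dist_commute[of k F n a u])
        then show "x \<in> (\<Union>x\<in>T. ?B x)" using x insert.prems by fastforce
      qed
      from insert.IH[OF this] obtain D where D: "finite D" "D \<subseteq> ?A"
        "\<forall>x\<in>D. \<forall>y\<in>D. x \<noteq> y \<longrightarrow> r \<le> bowen_dist k F n x y"
        "\<forall>a\<in>?A. \<exists>x\<in>D. bowen_dist k F n x a < r" by blast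
      have "\<exists>x\<in>insert a D. bowen_dist k F n x b < r" if "b \<in> A'" for b
        using D(4) that by (cases "r \<le> bowen_dist k F n a b") auto
      moreover have "\<forall>x\<in>insert a D. \<forall>y\<in>insert a D. x \<noteq> y \<longrightarrow> r \<le> bowen_dist k F n x y"
        using D(2,3) by (auto simp: bowen_dist_commute[of k F n _ a])
      ultimately show ?thesis
        using D(1,2) a(1) by (intro exI[of _ "insert a D"]) auto
    qed
  qed
  then show ?thesis using subset_trans[OF subset_UNIV T(2), of A] by meson
qed

section \<open>Packing sums\<close>

lemma weight_pos: "0 < weight \<alpha> c"
  by (cases c) simp

lemma packing_sum_upper:
  assumes "C \<in> packings k F n \<epsilon> Z" "finite C"
  shows "ennreal (\<Sum>c\<in>C. weight \<alpha> c) \<le> packing_sum k F f n \<alpha> \<epsilon> Z"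
proof -
  have "ennreal (\<Sum>c\<in>C. weight \<alpha> c) = (\<Sum>c\<in>C. ennreal (weight \<alpha> c))"
    by (rule sum_ennreal[symmetric]) (rule less_imp_le[OF weight_pos])
  also have "\<dots> = infsum (\<lambda>(x, m). ennreal (exp (- \<alpha> * word_count m + orbit_sum k F f m x))) C"
    using assms(2) by (simp add: case_prod_unfold)
  also have "\<dots> \<le> packing_sum k F f n \<alpha> \<epsilon> Z"
    unfolding packing_sum_def using assms(1) by (rule SUP_upper)
  finally show ?thesis .
qed

lemma packing_sum_lessD:
  assumes "a < packing_sum k F f n \<alpha> \<epsilon> Z"
  obtains C where "C \<in> packings k F n \<epsilon> Z" "finite C" "a < ennreal (\<Sum>c\<in>C. weight \<alpha> c)"
proof -
  let ?h = "\<lambda>(x, m). ennreal (exp (- \<alpha> * word_count m + orbit_sum k F f m x))"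
  from assms obtain C where C: "C \<in> packings k F n \<epsilon> Z" "a < infsum ?h C"
    unfolding packing_sum_def less_SUP_iff by blast
  then obtain D where D: "finite D" "D \<subseteq> C" "a < sum ?h D"
    by (subst (asm) nonneg_infsum_complete) (auto simp: less_SUP_iff)
  have "D \<in> packings k F n \<epsilon> Z"
    using C(1) D(2) countable_subset disjoint_family_on_mono[OF D(2)]
    unfolding packings_def by blast
  moreover have "sum ?h D = ennreal (\<Sum>c\<in>D. weight \<alpha> c)"
    by (subst sum_ennreal[symmetric]) (auto simp: less_imp_le weight_pos intro!: sum.cong)
  ultimately show thesis using D that by auto
qed

lemma packing_sum_antimono: "m \<le> n \<Longrightarrow> packing_sum k F f n \<alpha> \<epsilon> Z \<le> packing_sum k F f m \<alpha> \<epsilon> Z"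
  unfolding packing_sum_def by (rule SUP_subset_mono) (fastforce simp: packings_def)+

lemma packing_premeasure_eq_INF:
  "packing_premeasure k F f \<alpha> \<epsilon> Z = (INF n. packing_sum k F f n \<alpha> \<epsilon> Z)"
  unfolding packing_premeasure_def
  by (intro limI LIMSEQ_INF) (simp add: decseq_def packing_sum_antimono)

lemma packing_premeasure_mono:
  assumes "A \<subseteq> B"
  shows "packing_premeasure k F f \<alpha> \<epsilon> A \<le> packing_premeasure k F f \<alpha> \<epsilon> B"
  unfolding packing_premeasure_eq_INF packing_sum_def
  by (intro INF_mono' SUP_subset_mono) (use assms in \<open>fastforce simp: packings_def\<close>)+

lemma packing_premeasure_mono_scale:
  assumes "\<epsilon> \<le> \<epsilon>'"
  shows "packing_premeasure k F f \<alpha> \<epsilon> A \<le> packing_premeasure k F f \<alpha> \<epsilon>' A"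
proof -
  have "bowen_cball k F m \<epsilon>' x \<subseteq> bowen_cball k F m \<epsilon> x" for m x
  proof -
    have "exp (- real m * \<epsilon>') \<le> exp (- real m * \<epsilon>)" using assms by (simp add: mult_left_mono)
    then show ?thesis unfolding bowen_cball_def using order_trans by blast
  qed
  then have "packings k F n \<epsilon> A \<subseteq> packings k F n \<epsilon>' A" for n
    unfolding packings_def disjoint_family_on_def by (fastforce simp: case_prod_unfold)
  then show ?thesis
    unfolding packing_premeasure_eq_INF packing_sum_def
    by (intro INF_mono' SUP_subset_mono) auto
qed

text \<open>
  Raising the exponent by \<open>t - s\<close> gains the factor \<open>exp (- (t - s) * word_count n)\<close> on balls of order
  at least \<open>n\<close>, which beats any finite bound.
\<close>

lemma packing_premeasure_eq_0:
  assumes "packing_premeasure k F f s \<epsilon> A < \<infinity>" "s < t"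
  shows "packing_premeasure k F f t \<epsilon> A = 0"
proof -
  from assms(1) obtain N where N: "packing_sum k F f N s \<epsilon> A < \<infinity>"
    unfolding packing_premeasure_eq_INF INF_less_iff by auto
  obtain c where c: "packing_sum k F f N s \<epsilon> A = ennreal c" "0 \<le> c"
    using N by (cases "packing_sum k F f N s \<epsilon> A") auto
  have bound: "packing_premeasure k F f t \<epsilon> A \<le> ennreal (exp (- (t - s) * real n) * c)" if "N \<le> n" for n
  proof -
    have "packing_sum k F f n t \<epsilon> A \<le> ennreal (exp (- (t - s) * real n) * c)"
    proof (rule ccontr)
      assume "\<not> ?thesis"
      then have "ennreal (exp (- (t - s) * real n) * c) < packing_sum k F f n t \<epsilon> A" by simp
      then obtain C where C: "C \<in> packings k F n \<epsilon> A" "finite C"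
        "ennreal (exp (- (t - s) * real n) * c) < ennreal (\<Sum>c\<in>C. weight t c)"
        by (rule packing_sum_lessD)
      have "weight t p \<le> exp (- (t - s) * real n) * weight s p" if "p \<in> C" for p
      proof -
        obtain x m where p: "p = (x, m)" by (cases p)
        have "n \<le> m" using that C(1) p by (auto simp: packings_def)
        then have "real n \<le> word_count m" using word_count_ge[of m] by linarith
        then have "(t - s) * real n \<le> (t - s) * word_count m" using assms(2) by (intro mult_left_mono) auto
        then have "- t * word_count m + orbit_sum k F f m x
            \<le> - (t - s) * real n + (- s * word_count m + orbit_sum k F f m x)"
          by (simp add: algebra_simps)
        then show ?thesis unfolding p by (simp flip: exp_add)
      qed
      then have "(\<Sum>p\<in>C. weight t p) \<le> exp (- (t - s) * real n) * (\<Sum>p\<in>C. weight s p)"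
        unfolding sum_distrib_left by (rule sum_mono)
      moreover have "(\<Sum>p\<in>C. weight s p) \<le> c"
      proof -
        have "ennreal (\<Sum>p\<in>C. weight s p) \<le> packing_sum k F f n s \<epsilon> A"
          using C by (intro packing_sum_upper)
        also have "\<dots> \<le> ennreal c" using packing_sum_antimono[OF \<open>N \<le> n\<close>] c by metis
        finally show ?thesis using c(2) by simp
      qed
      ultimately have "(\<Sum>p\<in>C. weight t p) \<le> exp (- (t - s) * real n) * c"
        by (meson exp_ge_zero mult_left_mono order_trans)
      then show False using C(3) by (meson ennreal_leI leD)
    qed
    moreover have "packing_premeasure k F f t \<epsilon> A \<le> packing_sum k F f n t \<epsilon> A"
      unfolding packing_premeasure_eq_INF by (rule INF_lower) simp
    ultimately show ?thesis by simp
  qed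
  have "(\<lambda>n. exp (- (t - s)) ^ n * c) \<longlonglongrightarrow> 0 * c"
    using assms(2) by (intro tendsto_mult tendsto_const LIMSEQ_power_zero) auto
  moreover have "exp (- (t - s)) ^ n = exp (- (t - s) * real n)" for n
    by (simp add: exp_of_nat_mult[symmetric] mult.commute)
  ultimately have "(\<lambda>n. ennreal (exp (- (t - s) * real n) * c)) \<longlonglongrightarrow> ennreal 0"
    by (intro tendsto_ennrealI) simp
  then have "packing_premeasure k F f t \<epsilon> A \<le> ennreal 0"
    by (rule LIMSEQ_le_const) (use bound in blast)
  then show ?thesis by simp
qed

end


section \<open>Splitting the unit interval\<close>

abbreviation unit_uniform :: "real measure" where
  "unit_uniform \<equiv> uniform_measure lborel {0..1}"

lemma measurable_count_space_mono:
  assumes "\<psi> \<in> M \<rightarrow>\<^sub>M count_space A" "A \<subseteq> B"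
  shows "\<psi> \<in> M \<rightarrow>\<^sub>M count_space B"
  by (rule measurable_compose[OF assms(1), of "\<lambda>x. x"]) (use assms(2) in auto)

lemma prob_space_unit_uniform: "prob_space unit_uniform"
  by (rule prob_space_uniform_measure) auto

lemma measure_unit_uniform_le:
  assumes "t \<le> u"
  shows "measure unit_uniform {t<..u} \<le> u - t"
proof -
  have "measure unit_uniform {t<..u} = measure lborel ({0..1} \<inter> {t<..u})"
    by simp
  also have "\<dots> \<le> measure lborel {t<..u}"
    using assms by (intro measure_mono_fmeasurable) (auto simp: fmeasurable_def)
  finally show ?thesis using assms by simp
qed

lemma unit_uniform_intermediate_measure:
  assumes A: "A \<in> sets borel" and q: "0 \<le> q" "q \<le> measure unit_uniform A"
  obtains B where "B \<in> sets borel" "B \<subseteq> A" "measure unit_uniform B = q"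
proof -
  interpret prob_space unit_uniform by (rule prob_space_unit_uniform)
  define g where "g t = measure unit_uniform (A \<inter> {..t})" for t
  have step: "\<bar>g u - g t\<bar> \<le> u - t" if "t \<le> u" for t u
  proof -
    have "A \<inter> {..u} = A \<inter> {..t} \<union> A \<inter> {t<..u}" using that by auto
    then have "g u = g t + measure unit_uniform (A \<inter> {t<..u})"
      unfolding g_def using A by (subst finite_measure_Union[symmetric]) auto
    moreover have "measure unit_uniform (A \<inter> {t<..u}) \<le> measure unit_uniform {t<..u}"
      using A by (intro finite_measure_mono) auto
    ultimately show ?thesis using measure_unit_uniform_le[OF that] by simp
  qed
  have "1-lipschitz_on {0..1} g"
  proof (rule lipschitz_onI)
    fix t u :: real
    show "dist (g t) (g u) \<le> 1 * dist t u"
      using step[of t u] step[of u t] by (cases "t \<le> u") (auto simp: dist_real_def)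
  qed simp
  then have "continuous_on {0..1} g" by (rule lipschitz_on_continuous_on)
  moreover have "g 0 \<le> q"
  proof -
    have "g 0 = measure lborel ({0..1} \<inter> (A \<inter> {..0}))"
      unfolding g_def using A by simp
    also have "\<dots> \<le> measure lborel {0::real}"
      by (intro measure_mono_fmeasurable) (use A in \<open>auto simp: fmeasurable_def\<close>)
    finally show ?thesis using q by simp
  qed
  moreover have "g 1 = measure unit_uniform A"
  proof -
    have "{0..1} \<inter> (A \<inter> {..1}) = {0..1} \<inter> A" by auto
    then show ?thesis unfolding g_def using A by simp
  qed
  ultimately obtain t where "g t = q"
    using IVT'[of g 0 q 1] q by auto
  then show thesis using that[of "A \<inter> {..t}"] A by (auto simp: g_def)
qed

text \<open>
  The greedy choice: each member of \<open>E\<close> in turn receives as much of the remaining set as its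
  capacity permits, so total capacity at least the measure of \<open>A\<close> leaves nothing over.
\<close>

lemma unit_uniform_split:
  fixes w :: "'c \<Rightarrow> real"
  assumes "finite E" "E \<noteq> {}" "A \<in> sets borel"
    and "\<And>c. c \<in> E \<Longrightarrow> 0 \<le> w c" and "measure unit_uniform A \<le> (\<Sum>c\<in>E. w c)"
  shows "\<exists>\<psi>. \<psi> \<in> borel \<rightarrow>\<^sub>M count_space E \<and> (\<forall>c\<in>E. measure unit_uniform (A \<inter> \<psi> -` {c}) \<le> w c)"
  using assms
proof (induction E arbitrary: A rule: finite_ne_induct)
  case (singleton x)
  have "A \<inter> (\<lambda>_::real. x) -` {x} = A" by auto
  then show ?case using singleton by (intro exI[of _ "\<lambda>_. x"]) simp
next
  case (insert x E)
  interpret prob_space unit_uniform by (rule prob_space_unit_uniform)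
  obtain B where B: "B \<in> sets borel" "B \<subseteq> A"
      "measure unit_uniform B = min (w x) (measure unit_uniform A)"
    using unit_uniform_intermediate_measure[OF insert.prems(1), of "min (w x) (measure unit_uniform A)"]
      insert.prems(2) by auto
  have AB: "measure unit_uniform (A - B) = measure unit_uniform A - measure unit_uniform B"
    using insert.prems(1) B by (intro finite_measure_Diff) auto
  have "measure unit_uniform (A - B) \<le> sum w E"
  proof (cases "w x \<le> measure unit_uniform A")
    case True
    then show ?thesis using AB B(3) insert.prems(3) insert.hyps by simp
  next
    case False
    then show ?thesis using AB B(3) insert.prems(2) by (simp add: sum_nonneg)
  qed
  moreover have "A - B \<in> sets borel" using insert.prems(1) B(1) by (rule sets.Diff)
  ultimately have "\<exists>\<psi>. \<psi> \<in> borel \<rightarrow>\<^sub>M count_space E \<and>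
      (\<forall>c\<in>E. measure unit_uniform ((A - B) \<inter> \<psi> -` {c}) \<le> w c)"
    using insert.prems(2) by (intro insert.IH) blast+
  then obtain \<psi> where \<psi>: "\<psi> \<in> borel \<rightarrow>\<^sub>M count_space E"
      "\<forall>c\<in>E. measure unit_uniform ((A - B) \<inter> \<psi> -` {c}) \<le> w c"
    by blast
  let ?\<phi> = "\<lambda>t. if t \<in> B then x else \<psi> t"
  have \<psi>E: "\<psi> t \<in> E" for t using \<psi>(1) by (auto simp: measurable_def)
  have "\<psi> \<in> borel \<rightarrow>\<^sub>M count_space (insert x E)"
    using \<psi>(1) by (rule measurable_count_space_mono) auto
  then have "?\<phi> \<in> borel \<rightarrow>\<^sub>M count_space (insert x E)"
    using B(1) by (intro measurable_If_set) auto
  moreover have "A \<inter> ?\<phi> -` {x} = B" using B(2) \<psi>E insert.hyps by (auto split: if_splits)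
  moreover have "A \<inter> ?\<phi> -` {c} = (A - B) \<inter> \<psi> -` {c}" if "c \<in> E" for c
    using that insert.hyps by auto
  ultimately show ?case using B(3) \<psi>(2) by (intro exI[of _ ?\<phi>]) simp
qed

context free_semigroup_action
begin



section \<open>Measures are controlled by packings\<close>

lemma open_bowen_ball: "open (bowen_ball k F n \<epsilon> x)"
  unfolding bowen_ball_def by (rule open_bowen_dist_less)

lemma frequently_measure_bowen_ball_less:
  assumes "ereal s < local_pressure k F f \<mu> \<epsilon> x"
  shows "\<exists>\<^sub>F n in sequentially.
    measure \<mu> (bowen_ball k F n \<epsilon> x) < exp (- s * word_count n + orbit_sum k F f n x)"
proof (rule ccontr)
  assume "\<not> ?thesis"
  then have "\<forall>\<^sub>F n in sequentially.
      exp (- s * word_count n + orbit_sum k F f n x) \<le> measure \<mu> (bowen_ball k F n \<epsilon> x)"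
    by (simp add: not_frequently not_less)
  then have "\<forall>\<^sub>F n in sequentially. (neg_log (measure \<mu> (bowen_ball k F n \<epsilon> x))
      + ereal (orbit_sum k F f n x)) / ereal (word_count n) \<le> ereal s"
  proof eventually_elim
    case (elim n)
    let ?b = "measure \<mu> (bowen_ball k F n \<epsilon> x)"
    have b: "0 < ?b" using elim exp_gt_zero less_le_trans by blast
    then have "- s * word_count n + orbit_sum k F f n x \<le> ln ?b"
      using elim by (simp add: ln_ge_iff)
    then have "(- ln ?b + orbit_sum k F f n x) / word_count n \<le> s"
      using card_words_pos[of k n] by (simp add: divide_le_eq)
    then show ?case using b card_words_pos[of k n] by (simp add: neg_log_def)
  qed
  then have "local_pressure k F f \<mu> \<epsilon> x \<le> ereal s"
    unfolding local_pressure_def by (rule Limsup_bounded)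
  then show False using assms by simp
qed

text \<open>
  A maximal separated subset of the points whose \<open>n\<close>-ball is light covers these points by light
  balls, and at the finer scale it is a packing; the finite packing sums therefore bound the measure of
  the cover by a geometric sequence. By Borel--Cantelli, almost no point lies in infinitely many
  of the covers. The set \<open>A\<close> will come from an arbitrary cover of \<open>Z\<close>, so only the covers by balls, which
  are open, are ever measured.
\<close>

lemma AE_not_in_finite_packing_premeasure:
  assumes \<mu>: "\<mu> \<in> borel_probs" and scale: "\<epsilon> < \<epsilon>'" and "\<alpha> < s"
    and fin: "packing_premeasure k F f \<alpha> \<epsilon>' A < \<infinity>"
    and large: "\<And>x. x \<in> A \<Longrightarrow> ereal s < local_pressure k F f \<mu> \<epsilon> x"
  shows "AE x in \<mu>. x \<notin> A"
proof -
  interpret prob_space \<mu> using \<mu> by (simp add: borel_probs_def)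
  have sets_\<mu>: "sets \<mu> = sets borel" using \<mu> by (simp add: borel_probs_def)
  obtain N where N: "packing_sum k F f N \<alpha> \<epsilon>' A < \<infinity>"
    using fin unfolding packing_premeasure_eq_INF INF_less_iff by auto
  then obtain c where c: "packing_sum k F f N \<alpha> \<epsilon>' A = ennreal c" "0 \<le> c"
    by (cases "packing_sum k F f N \<alpha> \<epsilon>' A") auto
  define L where "L n = {x \<in> A. measure \<mu> (bowen_ball k F n \<epsilon> x)
      < exp (- s * word_count n + orbit_sum k F f n x)}" for n
  have "\<forall>n. \<exists>D. finite D \<and> D \<subseteq> L n
      \<and> (\<forall>x\<in>D. \<forall>y\<in>D. x \<noteq> y \<longrightarrow> exp (- real n * \<epsilon>) \<le> bowen_dist k F n x y)
      \<and> (\<forall>a\<in>L n. \<exists>x\<in>D. bowen_dist k F n x a < exp (- real n * \<epsilon>))"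
    by (intro allI finite_separated_cover) simp
  then obtain D where D': "\<forall>n. finite (D n) \<and> D n \<subseteq> L n
      \<and> (\<forall>x\<in>D n. \<forall>y\<in>D n. x \<noteq> y \<longrightarrow> exp (- real n * \<epsilon>) \<le> bowen_dist k F n x y)
      \<and> (\<forall>a\<in>L n. \<exists>x\<in>D n. bowen_dist k F n x a < exp (- real n * \<epsilon>))"
    by (rule choice[THEN exE])
  have D: "finite (D n)" "D n \<subseteq> L n"
      "\<And>x y. x \<in> D n \<Longrightarrow> y \<in> D n \<Longrightarrow> x \<noteq> y \<Longrightarrow> exp (- real n * \<epsilon>) \<le> bowen_dist k F n x y"
      "\<And>a. a \<in> L n \<Longrightarrow> \<exists>x\<in>D n. bowen_dist k F n x a < exp (- real n * \<epsilon>)" for n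
    using D'[THEN spec, of n] by auto
  define U where "U n = (\<Union>x\<in>D n. bowen_ball k F n \<epsilon> x)" for n
  have U_sets: "U n \<in> sets \<mu>" for n
    unfolding sets_\<mu> U_def using open_bowen_ball by (intro borel_open open_UN) auto
  have LU: "L n \<subseteq> U n" for n
    using D(4) by (auto simp: U_def bowen_ball_def)
  \<comment> \<open>From this order on, two balls of the finer scale with centres separated at the coarser one are disjoint.\<close>
  obtain M where M: "ln 2 / (\<epsilon>' - \<epsilon>) < real M" using reals_Archimedean2 by blast
  have bound: "measure \<mu> (U n) \<le> exp (- (s - \<alpha>)) ^ n * c" if "max N M \<le> n" for n
  proof -
    have "ln 2 < real M * (\<epsilon>' - \<epsilon>)" using M scale by (simp add: divide_less_eq)
    also have "\<dots> \<le> real n * (\<epsilon>' - \<epsilon>)" using that scale by (intro mult_right_mono) auto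
    finally have "ln 2 + - real n * \<epsilon>' < - real n * \<epsilon>" by (simp add: algebra_simps)
    then have "exp (ln 2 + - real n * \<epsilon>') < exp (- real n * \<epsilon>)" by (rule exp_less_mono)
    then have half: "2 * exp (- real n * \<epsilon>') < exp (- real n * \<epsilon>)"
      by (simp only: exp_add) simp
    have "bowen_cball k F n \<epsilon>' x \<inter> bowen_cball k F n \<epsilon>' y = {}"
      if "x \<in> D n" "y \<in> D n" "x \<noteq> y" for x y
    proof -
      have False if "bowen_dist k F n x z \<le> exp (- real n * \<epsilon>')"
          "bowen_dist k F n y z \<le> exp (- real n * \<epsilon>')" for z
        using that D(3)[OF \<open>x \<in> D n\<close> \<open>y \<in> D n\<close> \<open>x \<noteq> y\<close>] half
          bowen_dist_triangle[of k F n x y z] bowen_dist_commute[of k F n y z] by linarith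
      then show ?thesis by (auto simp: bowen_cball_def)
    qed
    then have "(\<lambda>x. (x, n)) ` D n \<in> packings k F n \<epsilon>' A"
      using D(1)[of n] D(2)[of n]
      by (auto simp: packings_def L_def disjoint_family_on_def countable_finite)
    then have "ennreal (\<Sum>p\<in>(\<lambda>x. (x, n)) ` D n. weight \<alpha> p) \<le> packing_sum k F f n \<alpha> \<epsilon>' A"
      using D(1) by (intro packing_sum_upper) auto
    also have "\<dots> \<le> ennreal c" using packing_sum_antimono[of N n] that c(1) by (metis max.bounded_iff)
    finally have "(\<Sum>p\<in>(\<lambda>x. (x, n)) ` D n. weight \<alpha> p) \<le> c" using c(2) by simp
    then have sum_c: "(\<Sum>x\<in>D n. weight \<alpha> (x, n)) \<le> c"
      by (subst (asm) sum.reindex) (auto simp: inj_on_def)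
    have "measure \<mu> (U n) \<le> (\<Sum>x\<in>D n. measure \<mu> (bowen_ball k F n \<epsilon> x))"
      unfolding U_def using D(1) open_bowen_ball
      by (intro finite_measure_subadditive_finite) (auto simp: sets_\<mu>)
    also have "\<dots> \<le> (\<Sum>x\<in>D n. exp (- (s - \<alpha>)) ^ n * weight \<alpha> (x, n))"
    proof (rule sum_mono)
      fix x assume "x \<in> D n"
      then have "measure \<mu> (bowen_ball k F n \<epsilon> x) \<le> exp (- s * word_count n + orbit_sum k F f n x)"
        using D(2)[of n] by (auto simp: L_def)
      also have "\<dots> = exp (- (s - \<alpha>) * word_count n) * weight \<alpha> (x, n)"
        by (simp add: algebra_simps flip: exp_add)
      also have "\<dots> \<le> exp (- (s - \<alpha>) * real n) * weight \<alpha> (x, n)"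
        using word_count_ge[of n] \<open>\<alpha> < s\<close> by (intro mult_right_mono) (simp_all add: mult_left_mono)
      also have "exp (- (s - \<alpha>) * real n) = exp (- (s - \<alpha>)) ^ n"
        by (simp add: exp_of_nat_mult[symmetric] mult.commute)
      finally show "measure \<mu> (bowen_ball k F n \<epsilon> x) \<le> exp (- (s - \<alpha>)) ^ n * weight \<alpha> (x, n)" .
    qed
    also have "\<dots> \<le> exp (- (s - \<alpha>)) ^ n * c"
      unfolding sum_distrib_left[symmetric] using sum_c by (intro mult_left_mono) auto
    finally show ?thesis .
  qed
  have "summable (\<lambda>n. exp (- (s - \<alpha>)) ^ n * c)"
    using \<open>\<alpha> < s\<close> by (intro summable_mult2 summable_geometric) simp
  then have "summable (\<lambda>n. measure \<mu> (U n))"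
    by (rule summable_comparison_test_ev[rotated])
      (use bound in \<open>auto simp: eventually_sequentially intro!: exI[of _ "max N M"]\<close>)
  then have "AE x in \<mu>. eventually (\<lambda>n. x \<in> space \<mu> - U n) sequentially"
    using U_sets by (intro borel_cantelli_AE1) (auto simp: less_top[symmetric])
  then show ?thesis
  proof eventually_elim
    case (elim x)
    show ?case
    proof
      assume "x \<in> A"
      then have "\<exists>\<^sub>F n in sequentially. x \<in> L n"
        using frequently_measure_bowen_ball_less[OF large] by (simp add: L_def)
      then have "\<exists>\<^sub>F n in sequentially. x \<in> U n"
        by (rule frequently_elim1) (use LU in blast)
      moreover from elim have "\<forall>\<^sub>F n in sequentially. x \<notin> U n"
        by (rule eventually_mono) simp
      ultimately show False by (simp add: frequently_def)
    qed
  qed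
qed

text \<open>
  A level \<open>\<alpha>\<close> strictly between the packing pressure and \<open>s\<close> has finite packing measure, which supplies a
  countable cover of \<open>Z\<close> by sets of finite premeasure.
\<close>

lemma measure_pressure_le:
  assumes \<mu>: "\<mu> \<in> borel_probs" and scale: "\<epsilon> < \<epsilon>'"
    and s: "packing_pressure_at k F f \<epsilon>' Z < ereal s" "0 \<le> s"
  shows "measure_pressure k F f \<mu> Z \<epsilon> \<le> ereal s"
proof -
  interpret prob_space \<mu> using \<mu> by (simp add: borel_probs_def)
  obtain \<alpha> where \<alpha>: "packing_pressure_at k F f \<epsilon>' Z < ereal \<alpha>" "ereal \<alpha> < ereal s"
    using ereal_dense2[OF s(1)] by blast
  have "packing_measure k F f \<alpha> \<epsilon>' Z \<noteq> \<infinity>"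
  proof
    assume "packing_measure k F f \<alpha> \<epsilon>' Z = \<infinity>"
    then have "ereal \<alpha> \<le> packing_pressure_at k F f \<epsilon>' Z"
      unfolding packing_pressure_at_def by (intro SUP_upper) simp
    then show False using \<alpha>(1) by simp
  qed
  then have "packing_measure k F f \<alpha> \<epsilon>' Z < \<infinity>" by (simp add: less_top)
  then obtain A :: "nat \<Rightarrow> 'a set" where A: "Z \<subseteq> (\<Union>i. A i)"
      "(\<Sum>i. packing_premeasure k F f \<alpha> \<epsilon>' (A i)) < \<infinity>"
    unfolding packing_measure_def INF_less_iff by auto
  let ?B = "\<lambda>i. {x \<in> A i. ereal s < local_pressure k F f \<mu> \<epsilon> x}"
  have "AE x in \<mu>. x \<notin> ?B i" for i
  proof (rule AE_not_in_finite_packing_premeasure[OF \<mu> scale])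
    have "packing_premeasure k F f \<alpha> \<epsilon>' (?B i) \<le> packing_premeasure k F f \<alpha> \<epsilon>' (A i)"
      by (rule packing_premeasure_mono) auto
    also have "\<dots> < \<infinity>" by (rule ennreal_suminf_lessD[OF A(2)])
    finally show "packing_premeasure k F f \<alpha> \<epsilon>' (?B i) < \<infinity>" .
  qed (use \<alpha> in auto)
  then have "AE x in \<mu>. \<forall>i. x \<notin> ?B i" by (subst AE_all_countable) blast
  then have "AE x in \<mu>. x \<in> Z \<longrightarrow> local_pressure k F f \<mu> \<epsilon> x \<le> ereal s"
    by (rule AE_mp) (intro AE_I2, use A(1) in \<open>auto simp: not_less\<close>)
  then have "(\<integral>\<^sup>+x\<in>Z. e2ennreal (local_pressure k F f \<mu> \<epsilon> x) \<partial>\<mu>) \<le> (\<integral>\<^sup>+x. ennreal s \<partial>\<mu>)"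
  proof (intro nn_integral_mono_AE, eventually_elim)
    case (elim x)
    have "e2ennreal (local_pressure k F f \<mu> \<epsilon> x) \<le> ennreal s" if "x \<in> Z"
      using e2ennreal_mono elim that by (fastforce simp: e2ennreal_ereal)
    then show ?case by (cases "x \<in> Z") auto
  qed
  also have "\<dots> = ennreal s" by (simp add: emeasure_space_1)
  finally have "enn2ereal (\<integral>\<^sup>+x\<in>Z. e2ennreal (local_pressure k F f \<mu> \<epsilon> x) \<partial>\<mu>) \<le> ereal s"
    using s(2) by (simp add: less_eq_ennreal.rep_eq)
  then show ?thesis
    unfolding measure_pressure_def ereal_set_integral_def
    by (rule order_trans[OF ereal_diff_le_self, rotated]) simp
qed


section \<open>The part of a set that carries packing pressure everywhere\<close>

lemma countable_base_of_compact_space: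
  "\<exists>\<B>::'a set set. countable \<B> \<and> (\<forall>G x. open G \<longrightarrow> x \<in> G \<longrightarrow> (\<exists>B\<in>\<B>. x \<in> B \<and> B \<subseteq> G))"
proof -
  have "\<forall>n::nat. \<exists>T::'a set. finite T \<and> UNIV \<subseteq> (\<Union>x\<in>T. ball x (1 / Suc n))"
    using compact_space unfolding compact_eq_totally_bounded by auto
  then obtain T :: "nat \<Rightarrow> 'a set"
    where T: "\<forall>n. finite (T n) \<and> UNIV \<subseteq> (\<Union>x\<in>T n. ball x (1 / Suc n))"
    by (rule choice[THEN exE])
  let ?\<B> = "\<Union>n. (\<lambda>x. ball x (1 / Suc n)) ` T n"
  have "\<exists>B\<in>?\<B>. x \<in> B \<and> B \<subseteq> G" if G: "open G" "x \<in> G" for G x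
  proof -
    obtain e where e: "0 < e" "ball x e \<subseteq> G" using G by (auto simp: open_contains_ball)
    obtain n where n: "1 / real (Suc n) < e / 2" using nat_approx_posE[of "e / 2"] e(1) by auto
    have "x \<in> (\<Union>y\<in>T n. ball y (1 / Suc n))"
      by (rule subsetD[OF conjunct2[OF T[THEN spec, of n]] UNIV_I])
    then obtain y where y: "y \<in> T n" "x \<in> ball y (1 / Suc n)" by blast
    have "ball y (1 / Suc n) \<subseteq> ball x e"
    proof
      fix z assume "z \<in> ball y (1 / Suc n)"
      then have "dist x z < e"
        using y(2) n dist_triangle[of x z y] by (simp add: dist_commute)
      then show "z \<in> ball x e" by simp
    qed
    then show ?thesis using y e(2) by blast
  qed
  moreover have "countable ?\<B>"
    using conjunct1[OF T[THEN spec]] by (intro countable_UN countable_image) (auto intro: countable_finite)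
  ultimately show ?thesis by (intro exI[of _ ?\<B>]) simp
qed

lemma packing_premeasure_empty: "packing_premeasure k F f \<alpha> \<epsilon> {} = 0"
proof -
  have "packing_sum k F f 0 \<alpha> \<epsilon> {} = 0"
  proof (rule ccontr)
    assume "\<not> ?thesis"
    then have "0 < packing_sum k F f 0 \<alpha> \<epsilon> {}" by (simp add: zero_less_iff_neq_zero)
    then obtain C where C: "C \<in> packings k F 0 \<epsilon> {}" "0 < ennreal (\<Sum>c\<in>C. weight \<alpha> c)"
      by (rule packing_sum_lessD)
    then have "C = {}" by (auto simp: packings_def)
    then show False using C(2) by simp
  qed
  then show ?thesis
    unfolding packing_premeasure_eq_INF by (metis INF_lower UNIV_I le_zero_eq)
qed

text \<open>
  Discarding all relatively open pieces that are countable unions of sets of finite premeasure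
  discards only countably many pieces of a countable base, so what is lost again has this form.
\<close>

lemma everywhere_infinite_premeasure_subset:
  assumes inf: "packing_measure k F f t \<epsilon> Z = \<infinity>" and "s < t"
  obtains Z' where "Z' \<subseteq> Z" "Z' \<noteq> {}"
    "\<And>G. open G \<Longrightarrow> Z' \<inter> G \<noteq> {} \<Longrightarrow> packing_premeasure k F f s \<epsilon> (Z' \<inter> G) = \<infinity>"
proof -
  define small where "small A \<longleftrightarrow>
    (\<exists>\<S>. countable \<S> \<and> A \<subseteq> \<Union>\<S> \<and> (\<forall>S\<in>\<S>. packing_premeasure k F f s \<epsilon> S < \<infinity>))" for A
  have small_UN: "small (\<Union>i\<in>I. A i)" if "countable I" "\<And>i. i \<in> I \<Longrightarrow> small (A i)"
    for I :: "'a set set" and A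
  proof -
    from that(2) have "\<forall>i\<in>I. \<exists>\<S>. countable \<S> \<and> A i \<subseteq> \<Union>\<S>
        \<and> (\<forall>S\<in>\<S>. packing_premeasure k F f s \<epsilon> S < \<infinity>)" by (simp add: small_def)
    then obtain \<S> where "\<forall>i\<in>I. countable (\<S> i) \<and> A i \<subseteq> \<Union>(\<S> i)
        \<and> (\<forall>S\<in>\<S> i. packing_premeasure k F f s \<epsilon> S < \<infinity>)" by (rule bchoice[THEN exE])
    then have \<S>: "\<And>i. i \<in> I \<Longrightarrow> countable (\<S> i)" "\<And>i. i \<in> I \<Longrightarrow> A i \<subseteq> \<Union>(\<S> i)"
        "\<And>i S. i \<in> I \<Longrightarrow> S \<in> \<S> i \<Longrightarrow> packing_premeasure k F f s \<epsilon> S < \<infinity>"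
      by blast+
    have "countable (\<Union>i\<in>I. \<S> i)" using that(1) \<S>(1) by (rule countable_UN)
    moreover have "(\<Union>i\<in>I. A i) \<subseteq> \<Union>(\<Union>i\<in>I. \<S> i)"
      by (intro UN_least subset_trans[OF \<S>(2)] Union_mono UN_upper)
    moreover have "\<forall>S\<in>(\<Union>i\<in>I. \<S> i). packing_premeasure k F f s \<epsilon> S < \<infinity>"
      by (rule ballI) (erule UN_E, rule \<S>(3))
    ultimately show ?thesis unfolding small_def by (intro exI conjI)
  qed
  have small_subset: "small B" if "small A" "B \<subseteq> A" for A B
    using that unfolding small_def by (meson order_trans)
  have "\<not> small Z"
  proof
    assume "small Z"
    then obtain \<S> where \<S>: "countable \<S>" "Z \<subseteq> \<Union>\<S>"
        "\<forall>S\<in>\<S>. packing_premeasure k F f s \<epsilon> S < \<infinity>" by (auto simp: small_def)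
    \<comment> \<open>The empty set is added because enumeration requires a nonempty family.\<close>
    let ?A = "from_nat_into (insert {} \<S>)"
    have "range ?A = insert {} \<S>" using \<S>(1) by (intro range_from_nat_into) auto
    then have A: "Z \<subseteq> (\<Union>i. ?A i)" "\<And>i. ?A i \<in> insert {} \<S>" using \<S>(2) by auto
    have "packing_premeasure k F f t \<epsilon> (?A i) = 0" for i
      using A(2)[of i] \<S>(3) packing_premeasure_empty packing_premeasure_eq_0[OF _ \<open>s < t\<close>] by auto
    then have "(\<Sum>i. packing_premeasure k F f t \<epsilon> (?A i)) = 0" by simp
    moreover have "packing_measure k F f t \<epsilon> Z \<le> (\<Sum>i. packing_premeasure k F f t \<epsilon> (?A i))"
      unfolding packing_measure_def using A(1) by (intro INF_lower) simp
    ultimately show False using inf by simp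
  qed
  obtain \<B> :: "'a set set" where \<B>: "countable \<B>"
      "\<And>G x. open G \<Longrightarrow> x \<in> G \<Longrightarrow> \<exists>B\<in>\<B>. x \<in> B \<and> B \<subseteq> G"
    using countable_base_of_compact_space by auto
  define \<N> where "\<N> = {B\<in>\<B>. small (Z \<inter> B)}"
  define Z' where "Z' = Z - \<Union>\<N>"
  have lost: "small (\<Union>B\<in>\<N>. Z \<inter> B)"
    using \<B>(1) by (intro small_UN) (auto simp: \<N>_def)
  have infinite: "packing_premeasure k F f s \<epsilon> (Z' \<inter> G) = \<infinity>" if G: "open G" "Z' \<inter> G \<noteq> {}" for G
  proof (rule ccontr)
    assume "packing_premeasure k F f s \<epsilon> (Z' \<inter> G) \<noteq> \<infinity>"
    then have fin: "packing_premeasure k F f s \<epsilon> (Z' \<inter> G) < \<infinity>" by (simp add: less_top)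
    obtain x where x: "x \<in> Z'" "x \<in> G" using G(2) by blast
    obtain B where B: "B \<in> \<B>" "x \<in> B" "B \<subseteq> G" using \<B>(2)[OF G(1) x(2)] by blast
    from lost obtain \<S> where \<S>: "countable \<S>" "(\<Union>B\<in>\<N>. Z \<inter> B) \<subseteq> \<Union>\<S>"
        "\<forall>S\<in>\<S>. packing_premeasure k F f s \<epsilon> S < \<infinity>" by (auto simp: small_def)
    have "Z \<inter> B \<subseteq> \<Union>(insert (Z' \<inter> G) \<S>)" using B(3) \<S>(2) by (auto simp: Z'_def)
    then have "small (Z \<inter> B)"
      unfolding small_def using \<S>(1,3) fin
      by (intro exI[of _ "insert (Z' \<inter> G) \<S>"]) auto
    then show False using B x(1) by (auto simp: \<N>_def Z'_def)
  qed
  have "Z' \<noteq> {}"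
  proof
    assume "Z' = {}"
    then have "Z \<subseteq> (\<Union>B\<in>\<N>. Z \<inter> B)" by (auto simp: Z'_def)
    then show False using small_subset[OF lost] \<open>\<not> small Z\<close> by blast
  qed
  then show thesis using infinite by (intro that[of Z']) (auto simp: Z'_def)
qed

section \<open>A measure with small Bowen balls\<close>

text \<open>
  Within the radius \<open>\<gamma>\<close>, the centre of a ball of order \<open>m\<close> may be moved: the ball of scale \<open>\<epsilon>'\<close> around the
  new centre stays inside the closed ball of scale \<open>\<epsilon>\<close> around the old one, and the weight changes by
  at most a factor \<open>exp 1\<close>.
\<close>

definition controlled :: "real \<Rightarrow> real \<Rightarrow> real \<Rightarrow> 'a \<times> nat \<Rightarrow> bool" where
  "controlled \<epsilon> \<epsilon>' \<gamma> = (\<lambda>(x, m). \<forall>y\<in>cball x \<gamma>.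
     bowen_dist k F m x y \<le> exp (- real m * \<epsilon>) - exp (- real m * \<epsilon>') \<and>
     \<bar>orbit_sum k F f m y - orbit_sum k F f m x\<bar> \<le> 1)"

lemma controlled_antimono: "controlled \<epsilon> \<epsilon>' \<gamma> c \<Longrightarrow> \<gamma>' \<le> \<gamma> \<Longrightarrow> controlled \<epsilon> \<epsilon>' \<gamma>' c"
  by (auto simp: controlled_def)

lemma exists_controlled:
  assumes "\<epsilon> < \<epsilon>'" "1 \<le> m"
  shows "\<exists>\<gamma>>0. controlled \<epsilon> \<epsilon>' \<gamma> (x, m)"
proof -
  let ?r = "exp (- real m * \<epsilon>) - exp (- real m * \<epsilon>')"
  let ?U = "{y. bowen_dist k F m x y < ?r} \<inter>
    {y. \<bar>orbit_sum k F f m y - orbit_sum k F f m x\<bar> < 1}"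
  have "open ?U"
    by (intro open_Int open_bowen_dist_less open_Collect_less continuous_intros continuous_orbit_sum)
  moreover have "x \<in> ?U" using assms by simp
  ultimately obtain \<gamma> where "0 < \<gamma>" "cball x \<gamma> \<subseteq> ?U"
    by (meson open_contains_cball)
  then show ?thesis unfolding controlled_def by (intro exI[of _ \<gamma>]) (fastforce simp: less_imp_le)
qed

lemma exists_uniformly_controlled:
  assumes "finite C" "\<epsilon> < \<epsilon>'" "\<And>c. c \<in> C \<Longrightarrow> 1 \<le> snd c" "0 < \<delta>"
  shows "\<exists>\<gamma>>0. \<gamma> \<le> \<delta> \<and> (\<forall>c\<in>C. controlled \<epsilon> \<epsilon>' \<gamma> c)"
  using assms(1,3)
proof (induction C)
  case empty
  then show ?case using assms(4) by auto
next
  case (insert c C)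
  obtain \<gamma> where \<gamma>: "0 < \<gamma>" "\<gamma> \<le> \<delta>" "\<forall>c\<in>C. controlled \<epsilon> \<epsilon>' \<gamma> c"
    using insert by auto
  obtain \<gamma>' where "0 < \<gamma>'" "controlled \<epsilon> \<epsilon>' \<gamma>' c"
    using exists_controlled[OF assms(2), of "snd c" "fst c"] insert.prems[of c] by auto
  with \<gamma> show ?case
    by (intro exI[of _ "min \<gamma> \<gamma>'"]) (auto intro: controlled_antimono)
qed

lemma cball_subset_bowen_cball:
  "controlled \<epsilon> \<epsilon>' \<gamma> (x, m) \<Longrightarrow> cball x \<gamma> \<subseteq> bowen_cball k F m \<epsilon> x"
proof
  fix y assume c: "controlled \<epsilon> \<epsilon>' \<gamma> (x, m)" and y: "y \<in> cball x \<gamma>"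
  have "bowen_dist k F m x y \<le> exp (- real m * \<epsilon>) - exp (- real m * \<epsilon>')"
    using c y by (auto simp: controlled_def)
  also have "\<dots> \<le> exp (- real m * \<epsilon>)" by simp
  finally show "y \<in> bowen_cball k F m \<epsilon> x" by (simp add: bowen_cball_def)
qed

text \<open>
  An infinite premeasure provides finite packings of total weight greater than one, which is enough
  capacity for any piece of the unit interval, whatever ball that piece belonged to before.
\<close>

lemma distribute_over_packing:
  assumes "packing_premeasure k F f s \<epsilon> S = \<infinity>" "A \<in> sets borel"
  shows "\<exists>E \<psi>. finite E \<and> E \<in> packings k F N \<epsilon> S \<and> \<psi> \<in> borel \<rightarrow>\<^sub>M count_space E \<and>
    (\<forall>c\<in>E. measure unit_uniform (A \<inter> \<psi> -` {c}) \<le> weight s c)"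
proof -
  interpret U: prob_space unit_uniform by (rule prob_space_unit_uniform)
  have "packing_premeasure k F f s \<epsilon> S \<le> packing_sum k F f N s \<epsilon> S"
    unfolding packing_premeasure_eq_INF by (rule INF_lower) simp
  then have "1 < packing_sum k F f N s \<epsilon> S"
    using assms(1) by (simp add: top_unique)
  then obtain E where E: "E \<in> packings k F N \<epsilon> S" "finite E" "1 < ennreal (\<Sum>c\<in>E. weight s c)"
    by (rule packing_sum_lessD)
  have "1 < (\<Sum>c\<in>E. weight s c)"
    using E(3) ennreal_leI[of "\<Sum>c\<in>E. weight s c" 1] by (simp add: not_le[symmetric])
  then have "measure unit_uniform A \<le> (\<Sum>c\<in>E. weight s c)"
    using U.prob_le_1[of A] by linarith
  moreover have "E \<noteq> {}" using \<open>1 < (\<Sum>c\<in>E. weight s c)\<close> by auto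
  ultimately have "\<exists>\<psi>. \<psi> \<in> borel \<rightarrow>\<^sub>M count_space E \<and>
      (\<forall>c\<in>E. measure unit_uniform (A \<inter> \<psi> -` {c}) \<le> weight s c)"
    using E(2) assms(2) by (intro unit_uniform_split less_imp_le[OF weight_pos])
  then show ?thesis using E(1,2) by blast
qed

text \<open>
  One level of the tree: the packing \<open>C\<close>, a radius \<open>\<gamma>\<close> around all its centres within which the next level
  is placed, and the map \<open>\<phi>\<close> sending a parameter to its ball at this level. Only parameters in the unit
  interval carry mass, but \<open>\<phi>\<close> is total on the reals.
\<close>

definition stage :: "real \<Rightarrow> real \<Rightarrow> real \<Rightarrow> 'a set \<Rightarrow> nat \<Rightarrow>
    ('a \<times> nat) set \<times> real \<times> (real \<Rightarrow> 'a \<times> nat) \<Rightarrow> bool" where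
  "stage s \<epsilon> \<epsilon>' Z n = (\<lambda>(C, \<gamma>, \<phi>).
     finite C \<and> C \<in> packings k F (Suc n) \<epsilon> Z \<and> 0 < \<gamma> \<and> \<gamma> \<le> 1 / Suc n \<and>
     (\<forall>c\<in>C. controlled \<epsilon> \<epsilon>' \<gamma> c) \<and> \<phi> \<in> borel \<rightarrow>\<^sub>M count_space C \<and>
     (\<forall>c\<in>C. measure unit_uniform (\<phi> -` {c}) \<le> weight s c))"

lemma stage_disjoint:
  assumes "stage s \<epsilon> \<epsilon>' Z n (C, \<gamma>, \<phi>)" "c \<in> C" "d \<in> C"
    "z \<in> bowen_cball k F (snd c) \<epsilon> (fst c)" "z \<in> bowen_cball k F (snd d) \<epsilon> (fst d)"
  shows "c = d"
proof (rule ccontr)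
  assume "c \<noteq> d"
  moreover have "disjoint_family_on (\<lambda>(x, m). bowen_cball k F m \<epsilon> x) C"
    using assms(1) by (auto simp: stage_def packings_def)
  ultimately have "bowen_cball k F (snd c) \<epsilon> (fst c) \<inter> bowen_cball k F (snd d) \<epsilon> (fst d) = {}"
    using assms(2,3) by (auto simp: disjoint_family_on_def case_prod_unfold)
  then show False using assms(4,5) by blast
qed

lemma stage_cball_subset:
  assumes "stage s \<epsilon> \<epsilon>' Z n (C, \<gamma>, \<phi>)" "c \<in> C"
  shows "cball (fst c) \<gamma> \<subseteq> bowen_cball k F (snd c) \<epsilon> (fst c)"
  using assms by (intro cball_subset_bowen_cball) (auto simp: stage_def)

lemma stage_in: "stage s \<epsilon> \<epsilon>' Z n (C, \<gamma>, \<phi>) \<Longrightarrow> \<phi> t \<in> C"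
  by (auto simp: stage_def measurable_def)

lemma stage_0:
  assumes "packing_premeasure k F f s \<epsilon> Z = \<infinity>" "\<epsilon> < \<epsilon>'"
  shows "\<exists>S. stage s \<epsilon> \<epsilon>' Z 0 S"
proof -
  obtain C \<phi> where C: "finite C" "C \<in> packings k F (Suc 0) \<epsilon> Z" "\<phi> \<in> borel \<rightarrow>\<^sub>M count_space C"
      "\<forall>c\<in>C. measure unit_uniform (UNIV \<inter> \<phi> -` {c}) \<le> weight s c"
    using distribute_over_packing[OF assms(1), of UNIV "Suc 0"] by auto
  have "1 \<le> snd c" if "c \<in> C" for c using C(2) that by (auto simp: packings_def)
  then obtain \<gamma> where "0 < \<gamma>" "\<gamma> \<le> 1" "\<forall>c\<in>C. controlled \<epsilon> \<epsilon>' \<gamma> c"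
    using exists_uniformly_controlled[OF C(1) assms(2), of 1] by auto
  then show ?thesis using C by (intro exI[of _ "(C, \<gamma>, \<phi>)"]) (simp add: stage_def)
qed

text \<open>
  Packings of large order near a centre \<open>fst c\<close> consist of balls inside the ball \<open>c\<close>, so balls with
  different parents are disjoint because the parents are. In particular a ball of the new level has
  a unique parent, and its parameters all come from that parent's share.
\<close>

lemma stage_Suc:
  assumes inf: "\<And>G. open G \<Longrightarrow> Z \<inter> G \<noteq> {} \<Longrightarrow> packing_premeasure k F f s \<epsilon> (Z \<inter> G) = \<infinity>"
    and \<epsilon>: "0 < \<epsilon>" "\<epsilon> < \<epsilon>'" and st: "stage s \<epsilon> \<epsilon>' Z n (C, \<gamma>, \<phi>)"
  shows "\<exists>C' \<gamma>' \<phi>'. stage s \<epsilon> \<epsilon>' Z (Suc n) (C', \<gamma>', \<phi>') \<and> \<gamma>' \<le> \<gamma> / 2 \<and>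
    (\<forall>t. dist (fst (\<phi> t)) (fst (\<phi>' t)) \<le> \<gamma> / 2)"
proof -
  have C: "finite C" "C \<in> packings k F (Suc n) \<epsilon> Z" "0 < \<gamma>" "\<phi> \<in> borel \<rightarrow>\<^sub>M count_space C"
    using st by (auto simp: stage_def)
  obtain M where M: "- ln (\<gamma> / 2) / \<epsilon> < real M" using reals_Archimedean2 by blast
  define N where "N = max M (Suc (Suc n))"
  have small: "exp (- real m * \<epsilon>) \<le> \<gamma> / 2" if "N \<le> m" for m
  proof -
    have "- ln (\<gamma> / 2) / \<epsilon> < real m" using M that by (simp add: N_def)
    then have "- ln (\<gamma> / 2) < real m * \<epsilon>" using \<epsilon>(1) by (simp only: pos_divide_less_eq)
    then have "- real m * \<epsilon> \<le> ln (\<gamma> / 2)" by simp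
    then have "exp (- real m * \<epsilon>) \<le> exp (ln (\<gamma> / 2))" by (simp only: exp_le_cancel_iff)
    then show ?thesis using C(3) by simp
  qed
  have "\<forall>c\<in>C. \<exists>E \<psi>. finite E \<and> E \<in> packings k F N \<epsilon> (Z \<inter> ball (fst c) (\<gamma> / 2)) \<and>
      \<psi> \<in> borel \<rightarrow>\<^sub>M count_space E \<and>
      (\<forall>d\<in>E. measure unit_uniform (\<phi> -` {c} \<inter> \<psi> -` {d}) \<le> weight s d)"
  proof (intro ballI distribute_over_packing inf)
    fix c assume "c \<in> C"
    then have "fst c \<in> Z" using C(2) by (auto simp: packings_def)
    then show "Z \<inter> ball (fst c) (\<gamma> / 2) \<noteq> {}" using C(3) by (auto intro!: exI[of _ "fst c"])
    show "\<phi> -` {c} \<in> sets borel"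
      using measurable_sets[OF C(4), of "{c}"] \<open>c \<in> C\<close> by simp
  qed simp
  then obtain E where "\<forall>c\<in>C. \<exists>\<psi>. finite (E c) \<and> E c \<in> packings k F N \<epsilon> (Z \<inter> ball (fst c) (\<gamma> / 2)) \<and>
      \<psi> \<in> borel \<rightarrow>\<^sub>M count_space (E c) \<and>
      (\<forall>d\<in>E c. measure unit_uniform (\<phi> -` {c} \<inter> \<psi> -` {d}) \<le> weight s d)"
    by (rule bchoice[THEN exE])
  then obtain \<psi> where "\<forall>c\<in>C. finite (E c) \<and> E c \<in> packings k F N \<epsilon> (Z \<inter> ball (fst c) (\<gamma> / 2)) \<and>
      \<psi> c \<in> borel \<rightarrow>\<^sub>M count_space (E c) \<and>
      (\<forall>d\<in>E c. measure unit_uniform (\<phi> -` {c} \<inter> \<psi> c -` {d}) \<le> weight s d)"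
    by (rule bchoice[THEN exE])
  then have E: "\<And>c. c \<in> C \<Longrightarrow> finite (E c)"
      "\<And>c. c \<in> C \<Longrightarrow> E c \<in> packings k F N \<epsilon> (Z \<inter> ball (fst c) (\<gamma> / 2))"
      "\<And>c. c \<in> C \<Longrightarrow> \<psi> c \<in> borel \<rightarrow>\<^sub>M count_space (E c)"
      "\<And>c d. c \<in> C \<Longrightarrow> d \<in> E c \<Longrightarrow> measure unit_uniform (\<phi> -` {c} \<inter> \<psi> c -` {d}) \<le> weight s d"
    by blast+
  define C' where "C' = (\<Union>c\<in>C. E c)"
  define \<phi>' where "\<phi>' t = \<psi> (\<phi> t) t" for t
  have E_elem: "fst d \<in> Z" "dist (fst c) (fst d) < \<gamma> / 2" "N \<le> snd d" if "c \<in> C" "d \<in> E c" for c d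
    using E(2)[OF that(1)] that(2) by (auto simp: packings_def)
  have child: "bowen_cball k F (snd d) \<epsilon> (fst d) \<subseteq> bowen_cball k F (snd c) \<epsilon> (fst c)"
    if "c \<in> C" "d \<in> E c" for c d
  proof -
    have "bowen_cball k F (snd d) \<epsilon> (fst d) \<subseteq> cball (fst c) \<gamma>"
    proof
      fix z assume "z \<in> bowen_cball k F (snd d) \<epsilon> (fst d)"
      then have "dist (fst d) z \<le> \<gamma> / 2"
        using dist_le_bowen_dist[of "fst d" z k F "snd d"] small[OF E_elem(3)[OF that]]
        by (simp add: bowen_cball_def)
      then show "z \<in> cball (fst c) \<gamma>"
        using E_elem(2)[OF that] dist_triangle[of "fst c" z "fst d"] by simp
    qed
    also have "\<dots> \<subseteq> bowen_cball k F (snd c) \<epsilon> (fst c)"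
      by (rule stage_cball_subset[OF st that(1)])
    finally show ?thesis .
  qed
  have centre: "fst d \<in> bowen_cball k F (snd d) \<epsilon> (fst d)" for d
    by (simp add: bowen_cball_def)
  have parent_unique: "c = c'" if "c \<in> C" "d \<in> E c" "c' \<in> C" "d \<in> E c'" for c c' d
    using stage_disjoint[OF st that(1,3)] child[OF that(1,2)] child[OF that(3,4)] centre[of d] by blast
  have "disjoint_family_on (\<lambda>(x, m). bowen_cball k F m \<epsilon> x) C'"
    unfolding disjoint_family_on_def
  proof (intro ballI impI)
    fix d d' assume "d \<in> C'" "d' \<in> C'" "d \<noteq> d'"
    then obtain c c' where c: "c \<in> C" "d \<in> E c" "c' \<in> C" "d' \<in> E c'" by (auto simp: C'_def)
    show "(case d of (x, m) \<Rightarrow> bowen_cball k F m \<epsilon> x) \<inter> (case d' of (x, m) \<Rightarrow> bowen_cball k F m \<epsilon> x) = {}"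
    proof (cases "c = c'")
      case True
      then have "disjoint_family_on (\<lambda>(x, m). bowen_cball k F m \<epsilon> x) (E c)" "d' \<in> E c"
        using E(2)[OF c(1)] c by (auto simp: packings_def)
      then show ?thesis using c(2) \<open>d \<noteq> d'\<close> by (simp add: disjoint_family_on_def)
    next
      case False
      then have "bowen_cball k F (snd c) \<epsilon> (fst c) \<inter> bowen_cball k F (snd c') \<epsilon> (fst c') = {}"
        using stage_disjoint[OF st c(1,3)] by blast
      then show ?thesis
        using child[OF c(1,2)] child[OF c(3,4)] by (auto simp: case_prod_unfold)
    qed
  qed
  moreover have fin: "finite C'" using C(1) E(1) by (simp add: C'_def)
  moreover have elem: "fst d \<in> Z" "Suc (Suc n) \<le> snd d" if "d \<in> C'" for d
  proof -
    obtain c where c: "c \<in> C" "d \<in> E c" using \<open>d \<in> C'\<close> unfolding C'_def by (rule UN_E)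
    then show "fst d \<in> Z" "Suc (Suc n) \<le> snd d"
      using E_elem(1)[OF c] E_elem(3)[OF c] by (simp_all add: N_def)
  qed
  ultimately have pack: "C' \<in> packings k F (Suc (Suc n)) \<epsilon> Z"
    by (simp add: packings_def countable_finite case_prod_unfold)
  have pos: "0 < min (\<gamma> / 2) (1 / Suc (Suc n))" using C(3) by simp
  have "1 \<le> snd d" if "d \<in> C'" for d using elem(2)[OF that] by simp
  from exists_uniformly_controlled[OF fin \<epsilon>(2) this pos]
  obtain \<gamma>' where \<gamma>': "0 < \<gamma>'" "\<gamma>' \<le> min (\<gamma> / 2) (1 / Suc (Suc n))"
      "\<forall>c\<in>C'. controlled \<epsilon> \<epsilon>' \<gamma>' c"
    by blast
  have "\<phi>' \<in> borel \<rightarrow>\<^sub>M count_space C'"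
    unfolding \<phi>'_def
  proof (rule measurable_compose_countable'[OF _ C(4) countable_finite[OF C(1)]])
    fix c assume "c \<in> C"
    then have "E c \<subseteq> C'" unfolding C'_def by (rule UN_upper)
    then show "\<psi> c \<in> borel \<rightarrow>\<^sub>M count_space C'"
      using measurable_count_space_mono[OF E(3)[OF \<open>c \<in> C\<close>]] by simp
  qed
  moreover have \<phi>E: "\<phi>' t \<in> E (\<phi> t)" "\<phi> t \<in> C" for t
  proof -
    show "\<phi> t \<in> C" by (rule stage_in[OF st])
    from measurable_space[OF E(3)[OF this], of t] show "\<phi>' t \<in> E (\<phi> t)" by (simp add: \<phi>'_def)
  qed
  moreover have "measure unit_uniform (\<phi>' -` {d}) \<le> weight s d" if "d \<in> C'" for d
  proof -
    interpret U: prob_space unit_uniform by (rule prob_space_unit_uniform)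
    obtain c where c: "c \<in> C" "d \<in> E c" using \<open>d \<in> C'\<close> unfolding C'_def by (rule UN_E)
    have "\<phi>' -` {d} \<subseteq> \<phi> -` {c} \<inter> \<psi> c -` {d}"
    proof
      fix t assume "t \<in> \<phi>' -` {d}"
      then have t: "\<phi>' t = d" by simp
      then have "c = \<phi> t" using parent_unique[OF c \<phi>E(2)[of t]] \<phi>E(1)[of t] by simp
      then show "t \<in> \<phi> -` {c} \<inter> \<psi> c -` {d}" using t by (simp add: \<phi>'_def)
    qed
    moreover have "\<phi> -` {c} \<inter> \<psi> c -` {d} \<in> sets borel"
      using measurable_sets[OF C(4), of "{c}"] measurable_sets[OF E(3)[OF c(1)], of "{d}"] c by auto
    ultimately have "measure unit_uniform (\<phi>' -` {d}) \<le> measure unit_uniform (\<phi> -` {c} \<inter> \<psi> c -` {d})"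
      by (intro U.finite_measure_mono) auto
    then show ?thesis using E(4)[OF c] by linarith
  qed
  ultimately have "stage s \<epsilon> \<epsilon>' Z (Suc n) (C', \<gamma>', \<phi>')"
    using fin pack \<gamma>' by (simp add: stage_def)
  moreover have "dist (fst (\<phi> t)) (fst (\<phi>' t)) \<le> \<gamma> / 2" for t
    using E_elem(2)[OF \<phi>E(2,1)] by (rule less_imp_le)
  ultimately show ?thesis using \<gamma>'(2) by (intro exI[of _ C'] exI[of _ \<gamma>'] exI[of _ \<phi>']) simp
qed


text \<open>
  The closed balls around the points chosen by the successive stages are nested, so each parameter
  in the unit interval selects a point of \<open>Z\<close>, and the measure is the law of this point. The set \<open>K\<close> is
  the part of \<open>Z\<close> covered at every stage. A point of \<open>K\<close> has an ancestor at each stage; its Bowen ball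
  at scale \<open>\<epsilon>'\<close>, of the same order as the ancestor, lies in the ancestor and so contains only images of
  parameters assigned to the ancestor, which have measure at most the ancestor's weight.
\<close>

lemma exists_measure_with_small_bowen_balls:
  assumes inf: "packing_measure k F f t \<epsilon> Z = \<infinity>" and "s < t" and \<epsilon>: "0 < \<epsilon>" "\<epsilon> < \<epsilon>'"
    and Z: "closed Z"
  shows "\<exists>\<mu>\<in>borel_probs. \<exists>K\<subseteq>Z. closed K \<and> measure \<mu> K = 1 \<and>
    (\<forall>y\<in>K. \<forall>n. \<exists>m\<ge>n. measure \<mu> (bowen_ball k F m \<epsilon>' y)
       \<le> exp (- s * word_count m + orbit_sum k F f m y + 1))"
proof -
  interpret U: prob_space unit_uniform by (rule prob_space_unit_uniform)
  obtain Z' where Z': "Z' \<subseteq> Z" "Z' \<noteq> {}"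
      "\<And>G. open G \<Longrightarrow> Z' \<inter> G \<noteq> {} \<Longrightarrow> packing_premeasure k F f s \<epsilon> (Z' \<inter> G) = \<infinity>"
    by (rule everywhere_infinite_premeasure_subset[OF inf \<open>s < t\<close>]) blast
  have "packing_premeasure k F f s \<epsilon> Z' = \<infinity>"
    using Z'(3)[of UNIV] Z'(2) by simp
  then have base: "\<exists>S. stage s \<epsilon> \<epsilon>' Z' 0 S" using \<epsilon>(2) by (rule stage_0)
  define refines where "refines = (\<lambda>(C::('a \<times> nat) set, \<gamma>::real, \<phi>::real \<Rightarrow> 'a \<times> nat)
      (C'::('a \<times> nat) set, \<gamma>'::real, \<phi>'::real \<Rightarrow> 'a \<times> nat).
      \<gamma>' \<le> \<gamma> / 2 \<and> (\<forall>t. dist (fst (\<phi> t)) (fst (\<phi>' t)) \<le> \<gamma> / 2))"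
  have "\<exists>S'. stage s \<epsilon> \<epsilon>' Z' (Suc n) S' \<and> refines S S'" if st: "stage s \<epsilon> \<epsilon>' Z' n S" for n S
  proof -
    obtain C \<gamma> \<phi> where S: "S = (C, \<gamma>, \<phi>)" by (rule prod_cases3)
    obtain C' \<gamma>' \<phi>' where "stage s \<epsilon> \<epsilon>' Z' (Suc n) (C', \<gamma>', \<phi>')" "\<gamma>' \<le> \<gamma> / 2"
        "\<forall>t. dist (fst (\<phi> t)) (fst (\<phi>' t)) \<le> \<gamma> / 2"
      using stage_Suc[OF Z'(3) \<epsilon> st[unfolded S]] by blast
    then show ?thesis unfolding S refines_def by (intro exI[of _ "(C', \<gamma>', \<phi>')"]) simp
  qed
  from dependent_nat_choice[of "stage s \<epsilon> \<epsilon>' Z'" "\<lambda>_. refines", OF base this]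
  obtain S where S: "\<And>n. stage s \<epsilon> \<epsilon>' Z' n (S n)" "\<And>n. refines (S n) (S (Suc n))" by blast
  define C where "C n = fst (S n)" for n
  define \<gamma> where "\<gamma> n = fst (snd (S n))" for n
  define \<phi> where "\<phi> n = snd (snd (S n))" for n
  define X where "X n t = fst (\<phi> n t)" for n t
  have st: "stage s \<epsilon> \<epsilon>' Z' n (C n, \<gamma> n, \<phi> n)" for n
    using S(1)[of n] by (simp add: C_def \<gamma>_def \<phi>_def)
  have \<gamma>_half: "\<gamma> (Suc n) \<le> \<gamma> n / 2" and X_step: "dist (X n t) (X (Suc n) t) \<le> \<gamma> n / 2" for n t
    using S(2)[of n] by (simp_all add: refines_def \<gamma>_def \<phi>_def X_def case_prod_unfold)
  have \<gamma>: "0 < \<gamma> n" "\<gamma> n \<le> 1 / Suc n" for n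
    using st[of n] by (auto simp: stage_def)
  have fin: "finite (C n)" for n using st[of n] by (simp add: stage_def)
  have \<phi>_meas: "\<phi> n \<in> borel \<rightarrow>\<^sub>M count_space (C n)" for n using st[of n] by (simp add: stage_def)
  have in_C: "\<phi> n t \<in> C n" for n t by (rule stage_in[OF st])
  have C_elem: "fst c \<in> Z" "Suc n \<le> snd c" if "c \<in> C n" for c n
  proof -
    have "C n \<in> packings k F (Suc n) \<epsilon> Z'" using st[of n] by (simp add: stage_def)
    then have "fst c \<in> Z' \<and> Suc n \<le> snd c" using that by (cases c) (auto simp: packings_def)
    then show "fst c \<in> Z" "Suc n \<le> snd c" using Z'(1) by auto
  qed
  have nested: "cball (X n t) (\<gamma> n) \<supseteq> cball (X m t) (\<gamma> m)" if "n \<le> m" for n m t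
    using that
  proof (induction m rule: dec_induct)
    case (step m)
    have "cball (X (Suc m) t) (\<gamma> (Suc m)) \<subseteq> cball (X m t) (\<gamma> m)"
    proof
      fix z assume "z \<in> cball (X (Suc m) t) (\<gamma> (Suc m))"
      then have "dist (X m t) z \<le> \<gamma> m"
        using X_step[of m t] \<gamma>_half[of m] dist_triangle[of "X m t" z "X (Suc m) t"] by simp
      then show "z \<in> cball (X m t) (\<gamma> m)" by simp
    qed
    then show ?case using step.IH by (rule order_trans)
  qed simp
  have X_in: "X m t \<in> cball (X n t) (\<gamma> n)" if "n \<le> m" for n m t
    using nested[OF that, of t] \<gamma>(1)[of m] centre_in_cball[of "X m t" "\<gamma> m"] by (meson less_imp_le subsetD)
  have "\<exists>z. (\<lambda>n. X n t) \<longlonglongrightarrow> z" for t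
  proof -
    have "Cauchy (\<lambda>n. X n t)"
    proof (rule metric_CauchyI)
      fix e :: real assume "0 < e"
      then obtain M where M: "1 / real (Suc M) < e / 2" using nat_approx_posE[of "e / 2"] by auto
      have "dist (X m t) (X n t) < e" if "M \<le> m" "M \<le> n" for m n
        using X_in[OF that(1), of t] X_in[OF that(2), of t] \<gamma>(2)[of M] M
          dist_triangle3[of "X m t" "X n t" "X M t"] by simp
      then show "\<exists>M. \<forall>m\<ge>M. \<forall>n\<ge>M. dist (X m t) (X n t) < e" by blast
    qed
    then show ?thesis
      using compact_imp_complete[OF compact_space] unfolding complete_def by blast
  qed
  then obtain z where z: "\<And>t. (\<lambda>n. X n t) \<longlonglongrightarrow> z t" by metis
  have z_cball: "z t \<in> cball (X n t) (\<gamma> n)" for n t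
    by (rule Lim_in_closed_set[OF closed_cball _ _ z])
      (auto simp: eventually_sequentially intro!: exI[of _ n] X_in[simplified])
  have z_Z: "z t \<in> Z" for t
    using C_elem(1)[OF in_C] by (intro Lim_in_closed_set[OF Z _ _ z]) (auto simp: X_def)
  have "X n \<in> borel_measurable borel" for n
    unfolding X_def by (rule measurable_compose[OF \<phi>_meas]) simp
  then have z_meas: "z \<in> borel_measurable borel"
    using z by (rule borel_measurable_LIMSEQ_metric)
  then have z_meas': "z \<in> unit_uniform \<rightarrow>\<^sub>M borel" by simp
  define \<mu> where "\<mu> = distr unit_uniform borel z"
  have \<mu>: "\<mu> \<in> borel_probs"
    unfolding borel_probs_def \<mu>_def using U.prob_space_distr[OF z_meas'] by simp
  have \<mu>_eq: "measure \<mu> B = measure unit_uniform (z -` B)" if "B \<in> sets borel" for B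
    unfolding \<mu>_def using that z_meas' by (simp add: measure_distr)
  define K where "K = Z \<inter> (\<Inter>n. \<Union>c\<in>C n. cball (fst c) (\<gamma> n))"
  have "closed K" unfolding K_def using Z fin by (intro closed_Int closed_INT closed_UN) auto
  moreover have "K \<subseteq> Z" by (simp add: K_def)
  moreover have "measure \<mu> K = 1"
  proof -
    have "\<exists>c\<in>C n. z t \<in> cball (fst c) (\<gamma> n)" for n t
      using z_cball[of t n] in_C[of n t] unfolding X_def by blast
    then have "z t \<in> K" for t
      using z_Z by (simp add: K_def)
    then have "z -` K = space unit_uniform" by auto
    then show ?thesis using \<mu>_eq[of K] \<open>closed K\<close> U.prob_space by simp
  qed
  moreover have "\<exists>m\<ge>n. measure \<mu> (bowen_ball k F m \<epsilon>' y)
      \<le> exp (- s * word_count m + orbit_sum k F f m y + 1)" if "y \<in> K" for y n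
  proof -
    have "y \<in> (\<Union>c\<in>C n. cball (fst c) (\<gamma> n))" using \<open>y \<in> K\<close> unfolding K_def by blast
    then obtain c where c: "c \<in> C n" "y \<in> cball (fst c) (\<gamma> n)" by (rule UN_E)
    obtain x m where xm: "c = (x, m)" by (rule prod.exhaust)
    have ctl: "bowen_dist k F m x y \<le> exp (- real m * \<epsilon>) - exp (- real m * \<epsilon>')"
      "\<bar>orbit_sum k F f m y - orbit_sum k F f m x\<bar> \<le> 1"
      using st[of n] c xm by (auto simp: stage_def controlled_def)
    have "z -` bowen_ball k F m \<epsilon>' y \<subseteq> \<phi> n -` {c}"
    proof
      fix t assume "t \<in> z -` bowen_ball k F m \<epsilon>' y"
      then have "bowen_dist k F m y (z t) < exp (- real m * \<epsilon>')" by (simp add: bowen_ball_def)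
      then have "z t \<in> bowen_cball k F m \<epsilon> x"
        using ctl(1) bowen_dist_triangle[of k F m x "z t" y] by (simp add: bowen_cball_def)
      moreover have "z t \<in> bowen_cball k F (snd (\<phi> n t)) \<epsilon> (fst (\<phi> n t))"
        using z_cball[of t n] unfolding X_def by (rule subsetD[OF stage_cball_subset[OF st in_C]])
      ultimately show "t \<in> \<phi> n -` {c}"
        using stage_disjoint[OF st c(1) in_C, of "z t" t] xm by simp
    qed
    moreover have "\<phi> n -` {c} \<in> sets borel"
      using measurable_sets[OF \<phi>_meas, of "{c}" n] c(1) by simp
    ultimately have "measure unit_uniform (z -` bowen_ball k F m \<epsilon>' y)
        \<le> measure unit_uniform (\<phi> n -` {c})"
      by (intro U.finite_measure_mono) auto
    also have "\<dots> \<le> exp (- s * word_count m + orbit_sum k F f m x)"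
      using st[of n] c(1) xm by (auto simp: stage_def)
    also have "\<dots> \<le> exp (- s * word_count m + orbit_sum k F f m y + 1)"
      using ctl(2) by simp
    finally have "measure \<mu> (bowen_ball k F m \<epsilon>' y)
        \<le> exp (- s * word_count m + orbit_sum k F f m y + 1)"
      using \<mu>_eq[OF borel_open[OF open_bowen_ball]] by simp
    moreover have "n \<le> m" using C_elem(2)[OF c(1)] xm by simp
    ultimately show ?thesis by blast
  qed
  ultimately show ?thesis using \<mu> by (intro bexI[of _ \<mu>] exI[of _ K]) simp_all
qed

text \<open>The summand \<open>1\<close> in the exponent disappears in the limit since it is divided by \<open>word_count m\<close>.\<close>

lemma local_pressure_ge:
  assumes "\<And>n. \<exists>m\<ge>n. measure \<mu> (bowen_ball k F m \<epsilon> y)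
    \<le> exp (- s * word_count m + orbit_sum k F f m y + 1)"
  shows "ereal s \<le> local_pressure k F f \<mu> \<epsilon> y"
proof (rule ccontr)
  assume "\<not> ?thesis"
  then obtain s' where s': "local_pressure k F f \<mu> \<epsilon> y < ereal s'" "s' < s"
    using ereal_dense2[of "local_pressure k F f \<mu> \<epsilon> y" "ereal s"] by (auto simp: not_le)
  then have "\<forall>\<^sub>F n in sequentially. (neg_log (measure \<mu> (bowen_ball k F n \<epsilon> y))
      + ereal (orbit_sum k F f n y)) / ereal (word_count n) < ereal s'"
    unfolding local_pressure_def by (intro Limsup_lessD)
  then obtain N where N: "\<And>n. N \<le> n \<Longrightarrow> (neg_log (measure \<mu> (bowen_ball k F n \<epsilon> y))
      + ereal (orbit_sum k F f n y)) / ereal (word_count n) < ereal s'"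
    unfolding eventually_sequentially by blast
  obtain M where M: "1 / (s - s') < real M" using reals_Archimedean2 by blast
  obtain m where m: "max N M \<le> m" "measure \<mu> (bowen_ball k F m \<epsilon> y)
      \<le> exp (- s * word_count m + orbit_sum k F f m y + 1)" using assms by blast
  let ?b = "measure \<mu> (bowen_ball k F m \<epsilon> y)"
  have pos: "0 < word_count m" using card_words_pos[of k m] by simp
  have lt: "(neg_log ?b + ereal (orbit_sum k F f m y)) / ereal (word_count m) < ereal s'"
    using N[of m] m(1) by simp
  show False
  proof (cases "?b = 0")
    case True
    then show False using lt pos by (simp add: neg_log_def)
  next
    case False
    then have b: "0 < ?b" by (simp add: zero_less_measure_iff)
    have "ln ?b \<le> ln (exp (- s * word_count m + orbit_sum k F f m y + 1))"
      using m(2) b by (subst ln_le_cancel_iff) auto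
    then have "ln ?b \<le> - s * word_count m + orbit_sum k F f m y + 1" by (simp only: ln_exp)
    moreover have "(- ln ?b + orbit_sum k F f m y) / word_count m < s'"
      using lt pos False by (simp add: neg_log_def)
    then have "- ln ?b + orbit_sum k F f m y < s' * word_count m"
      using pos by (simp add: divide_less_eq)
    ultimately have "(s - s') * word_count m < 1" by (simp add: algebra_simps)
    moreover have "1 < (s - s') * word_count m"
    proof -
      have "1 / (s - s') < word_count m" using M m(1) word_count_ge[of m] by simp
      then show ?thesis using s'(2) by (simp add: divide_less_eq mult.commute)
    qed
    ultimately show False by simp
  qed
qed

text \<open>
  The set \<open>K\<close> of full measure is closed, hence measurable, so the lower bound on the local pressure holds
  almost everywhere; as \<open>s\<close> is nonnegative, the negative part of the integral vanishes.
\<close>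

lemma exists_measure_pressure_ge:
  assumes s: "ereal s < packing_pressure_at k F f \<epsilon> Z" "0 \<le> s"
    and \<epsilon>: "0 < \<epsilon>" "\<epsilon> < \<epsilon>'" and Z: "closed Z"
  shows "\<exists>\<mu>\<in>borel_probs. measure \<mu> Z = 1 \<and> ereal s \<le> measure_pressure k F f \<mu> Z \<epsilon>'"
proof -
  obtain t where t: "packing_measure k F f t \<epsilon> Z = \<infinity>" "s < t"
    using s(1) unfolding packing_pressure_at_def less_SUP_iff by auto
  obtain \<mu> K where \<mu>: "\<mu> \<in> borel_probs" and K: "K \<subseteq> Z" "closed K" "measure \<mu> K = 1"
    and small: "\<And>y n. y \<in> K \<Longrightarrow> \<exists>m\<ge>n. measure \<mu> (bowen_ball k F m \<epsilon>' y)
       \<le> exp (- s * word_count m + orbit_sum k F f m y + 1)"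
    using exists_measure_with_small_bowen_balls[OF t \<epsilon> Z] by blast
  interpret prob_space \<mu> using \<mu> by (simp add: borel_probs_def)
  have sets_\<mu>: "sets \<mu> = sets borel" using \<mu> by (simp add: borel_probs_def)
  have ge: "ereal s \<le> local_pressure k F f \<mu> \<epsilon>' y" if "y \<in> K" for y
    using small[OF that] by (rule local_pressure_ge)
  have "measure \<mu> K \<le> measure \<mu> Z"
    using K(1) Z by (intro finite_measure_mono) (auto simp: sets_\<mu>)
  then have Z1: "measure \<mu> Z = 1" using K(3) prob_le_1[of Z] by simp
  have "AE y in \<mu>. y \<in> K"
    using K(2,3) by (intro AE_prob_1)
  then have AE: "AE y in \<mu>. y \<in> Z \<and> ereal s \<le> local_pressure k F f \<mu> \<epsilon>' y"
    by (rule AE_mp) (intro AE_I2, use K(1) ge in auto)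
  have "(\<integral>\<^sup>+y\<in>Z. e2ennreal (- local_pressure k F f \<mu> \<epsilon>' y) \<partial>\<mu>) = (\<integral>\<^sup>+y. 0 \<partial>\<mu>)"
  proof (rule nn_integral_cong_AE, use AE in eventually_elim)
    case (elim y)
    then have "- local_pressure k F f \<mu> \<epsilon>' y \<le> 0"
      using s(2) by (metis ereal_less_eq(5) ereal_uminus_le_0_iff order_trans)
    then show ?case by (simp add: e2ennreal_neg)
  qed
  moreover have "(\<integral>\<^sup>+y. ennreal s \<partial>\<mu>) \<le> (\<integral>\<^sup>+y\<in>Z. e2ennreal (local_pressure k F f \<mu> \<epsilon>' y) \<partial>\<mu>)"
  proof (rule nn_integral_mono_AE, use AE in eventually_elim)
    case (elim y)
    then show ?case using e2ennreal_mono[of "ereal s"] by (simp add: e2ennreal_ereal)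
  qed
  then have "ennreal s \<le> (\<integral>\<^sup>+y\<in>Z. e2ennreal (local_pressure k F f \<mu> \<epsilon>' y) \<partial>\<mu>)"
    by (simp add: emeasure_space_1)
  then have "ereal s \<le> enn2ereal (\<integral>\<^sup>+y\<in>Z. e2ennreal (local_pressure k F f \<mu> \<epsilon>' y) \<partial>\<mu>)"
    using s(2) by (simp add: less_eq_ennreal.rep_eq)
  ultimately have "ereal s \<le> measure_pressure k F f \<mu> Z \<epsilon>'"
    unfolding measure_pressure_def ereal_set_integral_def by (simp add: zero_ennreal.rep_eq)
  then show ?thesis using \<mu> Z1 by blast
qed

section \<open>The limit of small scales\<close>

lemma packing_pressure_at_mono:
  assumes "\<epsilon> \<le> \<epsilon>'"
  shows "packing_pressure_at k F f \<epsilon> Z \<le> packing_pressure_at k F f \<epsilon>' Z"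
proof -
  have "packing_measure k F f \<alpha> \<epsilon> Z \<le> packing_measure k F f \<alpha> \<epsilon>' Z" for \<alpha>
    unfolding packing_measure_def
    by (intro INF_mono' suminf_le packing_premeasure_mono_scale[OF assms]) auto
  then have "packing_measure k F f \<alpha> \<epsilon>' Z = \<infinity>" if "packing_measure k F f \<alpha> \<epsilon> Z = \<infinity>" for \<alpha>
    using that by (metis infinity_ennreal_def top_unique)
  then show ?thesis
    unfolding packing_pressure_at_def by (intro SUP_subset_mono) auto
qed

lemma packing_pressure_at_tendsto:
  "((\<lambda>\<epsilon>. packing_pressure_at k F f \<epsilon> Z) \<longlongrightarrow> packing_pressure k F f Z) (at_right 0)"
  and packing_pressure_eq_INF:
  "packing_pressure k F f Z = (INF \<epsilon>\<in>{0<..}. packing_pressure_at k F f \<epsilon> Z)"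
proof -
  let ?P = "\<lambda>\<epsilon>. packing_pressure_at k F f \<epsilon> Z"
  have lim: "(?P \<longlongrightarrow> (INF \<epsilon>\<in>{0<..}. ?P \<epsilon>)) (at_right 0)"
  proof (rule decreasing_tendsto)
    show "\<forall>\<^sub>F \<epsilon> in at_right 0. (INF \<epsilon>\<in>{0<..}. ?P \<epsilon>) \<le> ?P \<epsilon>"
      by (auto simp: eventually_at_right_field intro!: INF_lower exI[of _ 1])
    fix a assume "(INF \<epsilon>\<in>{0<..}. ?P \<epsilon>) < a"
    then obtain \<epsilon> where "0 < \<epsilon>" "?P \<epsilon> < a" unfolding INF_less_iff by auto
    then show "\<forall>\<^sub>F \<epsilon> in at_right 0. ?P \<epsilon> < a"
      unfolding eventually_at_right_field
      by (intro exI[of _ \<epsilon>]) (metis le_less_trans less_imp_le packing_pressure_at_mono)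
  qed
  then show "packing_pressure k F f Z = (INF \<epsilon>\<in>{0<..}. ?P \<epsilon>)"
    unfolding packing_pressure_def by (intro tendsto_Lim) auto
  with lim show "(?P \<longlongrightarrow> packing_pressure k F f Z) (at_right 0)" by simp
qed

lemma sup_measure_pressure_tendsto:
  assumes "closed Z" and pos: "0 < packing_pressure k F f Z"
  shows "((\<lambda>\<epsilon>. SUP \<mu>\<in>{\<mu> \<in> borel_probs. measure \<mu> Z = 1}. measure_pressure k F f \<mu> Z \<epsilon>)
          \<longlongrightarrow> packing_pressure k F f Z) (at_right 0)"
proof -
  let ?S = "\<lambda>\<epsilon>. SUP \<mu>\<in>{\<mu> \<in> borel_probs. measure \<mu> Z = 1}. measure_pressure k F f \<mu> Z \<epsilon>"
  let ?P = "\<lambda>\<epsilon>. packing_pressure_at k F f \<epsilon> Z"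
  have P_le: "packing_pressure k F f Z \<le> ?P \<epsilon>" if "0 < \<epsilon>" for \<epsilon>
    unfolding packing_pressure_eq_INF using that by (intro INF_lower) simp
  have upper: "?S \<epsilon> \<le> ?P (2 * \<epsilon>)" if "0 < \<epsilon>" for \<epsilon>
  proof (rule SUP_least, rule ccontr)
    fix \<mu> assume \<mu>: "\<mu> \<in> {\<mu> \<in> borel_probs. measure \<mu> Z = 1}"
    assume "\<not> measure_pressure k F f \<mu> Z \<epsilon> \<le> ?P (2 * \<epsilon>)"
    then obtain s where s: "?P (2 * \<epsilon>) < ereal s" "ereal s < measure_pressure k F f \<mu> Z \<epsilon>"
      using ereal_dense2 by (metis not_le)
    have "0 < ?P (2 * \<epsilon>)" using pos P_le[of "2 * \<epsilon>"] \<open>0 < \<epsilon>\<close> by simp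
    then have "0 < ereal s" using s(1) by (rule less_trans)
    then have "0 \<le> s" by simp
    then have "measure_pressure k F f \<mu> Z \<epsilon> \<le> ereal s"
      using \<mu> s(1) \<open>0 < \<epsilon>\<close> by (intro measure_pressure_le[where \<epsilon>' = "2 * \<epsilon>"]) auto
    then show False using s(2) by simp
  qed
  have lower: "packing_pressure k F f Z \<le> ?S \<epsilon>" if "0 < \<epsilon>" for \<epsilon>
  proof (rule ccontr)
    assume "\<not> packing_pressure k F f Z \<le> ?S \<epsilon>"
    then have "max 0 (?S \<epsilon>) < packing_pressure k F f Z" using pos by simp
    then obtain s where s: "max 0 (?S \<epsilon>) < ereal s" "ereal s < packing_pressure k F f Z"
      using ereal_dense2 by blast
    have "ereal s < ?P (\<epsilon> / 2)" using s(2) P_le[of "\<epsilon> / 2"] \<open>0 < \<epsilon>\<close> by simp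
    moreover have "0 \<le> s" using s(1) by simp
    ultimately obtain \<mu> where \<mu>: "\<mu> \<in> borel_probs" "measure \<mu> Z = 1"
        "ereal s \<le> measure_pressure k F f \<mu> Z \<epsilon>"
      using exists_measure_pressure_ge[of s "\<epsilon> / 2" Z \<epsilon>] \<open>closed Z\<close> \<open>0 < \<epsilon>\<close> by auto
    have "measure_pressure k F f \<mu> Z \<epsilon> \<le> ?S \<epsilon>" using \<mu>(1,2) by (intro SUP_upper) simp
    with \<mu>(3) have "ereal s \<le> ?S \<epsilon>" by (rule order_trans)
    then show False using s(1) by (simp add: leD)
  qed
  have "((\<lambda>\<epsilon>. 2 * \<epsilon>) \<longlongrightarrow> 2 * 0) (at_right (0::real))"
    by (intro tendsto_intros)
  then have "filterlim (\<lambda>\<epsilon>. 2 * \<epsilon>) (at_right 0) (at_right (0::real))"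
    by (auto simp: filterlim_at eventually_at_right_field intro!: exI[of _ 1])
  then have lim: "((\<lambda>\<epsilon>. ?P (2 * \<epsilon>)) \<longlongrightarrow> packing_pressure k F f Z) (at_right 0)"
    by (rule filterlim_compose[OF packing_pressure_at_tendsto])
  show ?thesis
    by (rule tendsto_sandwich[OF _ _ tendsto_const lim])
      (auto simp: eventually_at_right_field intro!: exI[of _ 1] upper lower)
qed

end

theorem theorem3p1:
  fixes k :: nat
    and F :: "nat \<Rightarrow> 'a::metric_space \<Rightarrow> 'a"
    and f :: "'a \<Rightarrow> real"
    and Z :: "'a set"
  assumes "compact (UNIV :: 'a set)"
    and "1 \<le> k"
    and "\<And>i. i \<in> {1..k} \<Longrightarrow> continuous_on UNIV (F i)"
    and "continuous_on UNIV f"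
    and "compact Z" and "Z \<noteq> {}"
    and "packing_pressure k F f Z > ereal (SUP x. \<bar>f x\<bar>)"
  shows "((\<lambda>\<epsilon>. SUP \<mu>\<in>{\<mu> \<in> borel_probs. measure \<mu> Z = 1}. measure_pressure k F f \<mu> Z \<epsilon>)
          \<longlongrightarrow> packing_pressure k F f Z) (at_right 0)"
proof -
  interpret free_semigroup_action k F f
    using assms(1-4) by unfold_locales
  have "compact (range (\<lambda>x. \<bar>f x\<bar>))"
    using assms(1,4) by (intro compact_continuous_image continuous_intros)
  then have "bdd_above (range (\<lambda>x. \<bar>f x\<bar>))"
    by (intro bounded_imp_bdd_above compact_imp_bounded)
  then have "\<bar>f undefined\<bar> \<le> (SUP x. \<bar>f x\<bar>)" by (intro cSUP_upper) auto
  then have "0 \<le> ereal (SUP x. \<bar>f x\<bar>)" by simp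
  then have "0 < packing_pressure k F f Z" using assms(7) by (rule le_less_trans)
  then show ?thesis
    using assms(5) by (intro sup_measure_pressure_tendsto compact_imp_closed)
qed

end
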